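(* Let $n$ be an integer with $7\le n\le 15$ and let $W\subset\mathbb{E}^n$ be a convex body of constant width. Then $X(W)\le 3\cdot 2^{n-2}$ and $I(W)\le 2^n$, where $X(W)$ is the X-ray number and $I(W)$ is the illumination number of $W$.
   Context: $\mathbb{E}^n$ is the $n$-dimensional Euclidean space and $\mathbb{S}^{n-1}$ its unit sphere. A convex body in $\mathbb{E}^n$ is a convex compact set with non-empty interior. It has constant width if its orthogonal projection onto any line has length independent of the direction of the line. A point $x$ on the boundary of a convex body $K$ is illuminated along a direction $\xi\in\mathbb{S}^{n-1}$ if the ray $\{x+t\xi:t\ge 0\}$ intersects the interior of $K$. The body $K$ is illuminated along a set $E\subset\mathbb{S}^{n-1}$ if every boundary point of $K$ is illuminated along some $\xi\in E$. The illumination number $I(K)$ is the smallest cardinality of a set of directions illuminating $K$. A point $x\in K$ is X-rayed along a direction $\xi\in\mathbb{S}^{n-1}$ if the line $\{x+t\xi:t\in\mathbb{R}\}$ intersects the interior of $K$. The body $K$ is X-rayed by $E\subset\mathbb{S}^{n-1}$ if every point $x\in K$ is X-rayed along some $\xi\in E$. The X-ray number $X(K)$ is the smallest cardinality of a set of directions X-raying $K$. *)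

theory Defs
  imports "HOL-Analysis.Analysis" "HOL-Library.Extended_Nat"
begin

definition convex_body :: "'a::euclidean_space set \<Rightarrow> bool" where
  "convex_body K \<longleftrightarrow> convex K \<and> compact K \<and> interior K \<noteq> {}"

text \<open>For a unit vector \<open>u\<close> this is the orthogonal projection onto the line
  \<open>{a + t *\<^sub>R u |t. True}\<close>.\<close>

definition line_proj :: "'a::euclidean_space \<Rightarrow> 'a \<Rightarrow> 'a \<Rightarrow> 'a" where
  "line_proj a u x = a + ((x - a) \<bullet> u) *\<^sub>R u"

text \<open>The projection of a convex body onto a line is a segment; its length is its diameter.\<close>

definition constant_width :: "'a::euclidean_space set \<Rightarrow> bool" where
  "constant_width K \<longleftrightarrow>
     (\<exists>w. \<forall>a. \<forall>u\<in>sphere 0 1. diameter (line_proj a u ` K) = w)"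

definition illuminated_along :: "'a::euclidean_space set \<Rightarrow> 'a \<Rightarrow> 'a \<Rightarrow> bool" where
  "illuminated_along K x \<xi> \<longleftrightarrow> {x + t *\<^sub>R \<xi> |t. t \<ge> 0} \<inter> interior K \<noteq> {}"

definition illuminates :: "'a::euclidean_space set \<Rightarrow> 'a set \<Rightarrow> bool" where
  "illuminates E K \<longleftrightarrow>
     E \<subseteq> sphere 0 1 \<and> (\<forall>x\<in>frontier K. \<exists>\<xi>\<in>E. illuminated_along K x \<xi>)"

definition xrayed_along :: "'a::euclidean_space set \<Rightarrow> 'a \<Rightarrow> 'a \<Rightarrow> bool" where
  "xrayed_along K x \<xi> \<longleftrightarrow> {x + t *\<^sub>R \<xi> |t. True} \<inter> interior K \<noteq> {}"

definition xrays :: "'a::euclidean_space set \<Rightarrow> 'a set \<Rightarrow> bool" where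
  "xrays E K \<longleftrightarrow>
     E \<subseteq> sphere 0 1 \<and> (\<forall>x\<in>K. \<exists>\<xi>\<in>E. xrayed_along K x \<xi>)"

text \<open>The minimal cardinalities are extended naturals, so that they are \<open>\<infinity>\<close> (and not
  a junk value such as \<open>0\<close>) when no finite set of directions works. Infima of nonempty sets of
  extended naturals are attained.\<close>

definition illumination_number :: "'a::euclidean_space set \<Rightarrow> enat" where
  "illumination_number K = (INF E\<in>{E. finite E \<and> illuminates E K}. enat (card E))"

definition xray_number :: "'a::euclidean_space set \<Rightarrow> enat" where
  "xray_number K = (INF E\<in>{E. finite E \<and> xrays E K}. enat (card E))"

end

theory Submission
  imports Defs
begin

text \<open>Illumination is governed by the normals. At a point of a body of constant width the unit normals are
  pairwise at an angle of at most 60 degrees (\<open>constant_width_normals\<close>), so they fit into a cap around some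
  centre, of a radius bounded in terms of the dimension (\<open>jung_cap\<close>). A direction illuminates the point as soon as
  it is obtuse to all of them, and this holds if it is closer than the complementary angle to the antipode of the
  centre (\<open>constant_width_illumination_axis\<close>). It therefore suffices to cover the unit sphere of dimension \<open>n - 1\<close> by
  caps of that angle, which is slightly more than 45 degrees: its cosine is \<open>sqrt (n / (2 * (n + 1)))\<close>.

  The centres of the covering are explicit sign vectors: the half cube, that is, the \<open>2 ^ (n - 1)\<close> normalised
  vectors with entries \<open>1\<close> and \<open>- 1\<close> and an even number of negative ones, together with the vectors with
  entries \<open>1\<close> and \<open>- 1\<close> on a small support (\<open>supports\<close>) and \<open>0\<close> elsewhere, also normalised. For
  \<open>n = 8\<close> these are the 240 minimal vectors of the \<open>E\<^sub>8\<close> lattice and the coordinate vectors. The latter family is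
  symmetric and has at most \<open>2 ^ (n - 1)\<close> members (\<open>card_sign_vecs_supports\<close>). So the two
  families together have at most \<open>2 ^ n\<close> members, which settles illumination; for X-raying one vector of each
  antipodal pair in the second family is enough, which leaves at most \<open>3 * 2 ^ (n - 2)\<close>.

  That the caps cover the sphere (\<open>sign_vecs_half_cube_cover\<close>) is a statement about the decreasing sequence of
  the absolute values of the coordinates: if the inner products with all the centres are small, then
  certain partial sums of this sequence are small, and then the sum of its squares is too small for a unit vector
  (\<open>profile_bound\<close>). This maximises a convex function over a polytope. The flat tail of the sequence is
  eliminated by \<open>tail_bound\<close>; for the few remaining terms, summation by parts and constant bounds for the
  partial sums reduce the claim to linear inequalities.\<close>

section \<open>Normals of a body of constant width\<close>

definition unit_normals :: "'a::euclidean_space set \<Rightarrow> 'a \<Rightarrow> 'a set" where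
  "unit_normals K x = {u. norm u = 1 \<and> (\<forall>y\<in>K. y \<bullet> u \<le> x \<bullet> u)}"

lemma constant_width_inner:
  fixes W :: "'a::euclidean_space set"
  assumes "convex_body W" "constant_width W"
  obtains w where "\<And>u x y. norm u = 1 \<Longrightarrow> x \<in> W \<Longrightarrow> y \<in> W \<Longrightarrow> (x - y) \<bullet> u \<le> w"
    and "\<And>u. norm u = 1 \<Longrightarrow> \<exists>x\<in>W. \<exists>y\<in>W. (x - y) \<bullet> u = w"
    and "w > 0"
proof -
  obtain w where w: "\<And>a u. norm u = 1 \<Longrightarrow> diameter (line_proj a u ` W) = w"
    using assms(2) unfolding constant_width_def by auto
  have W: "compact W" "W \<noteq> {}" "interior W \<noteq> {}"
    using assms(1) interior_subset unfolding convex_body_def by auto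
  have dist_proj: "dist (line_proj 0 u x) (line_proj 0 u y) = \<bar>(x - y) \<bullet> u\<bar>"
    if "norm u = 1" for u x y :: 'a
    using that by (simp add: line_proj_def dist_norm inner_diff_left flip: scaleR_left_diff_distrib)
  have compact_proj: "compact (line_proj 0 u ` W)" for u
    unfolding line_proj_def by (intro compact_continuous_image continuous_intros W(1))
  have le: "(x - y) \<bullet> u \<le> w" if "norm u = 1" "x \<in> W" "y \<in> W" for u x y
    using diameter_bounded_bound[OF compact_imp_bounded[OF compact_proj[of u]],
        of "line_proj 0 u x" "line_proj 0 u y"]
      that w[of u 0] dist_proj[of u x y] by auto
  have attained: "\<exists>x\<in>W. \<exists>y\<in>W. (x - y) \<bullet> u = w" if u: "norm u = 1" for u
  proof -
    obtain x y where "x \<in> W" "y \<in> W" "dist (line_proj 0 u x) (line_proj 0 u y) = w"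
      using diameter_compact_attained[OF compact_proj[of u]] W(2) w[OF u, of 0] by auto
    then have xy: "x \<in> W" "y \<in> W" "\<bar>(x - y) \<bullet> u\<bar> = w"
      using dist_proj[OF u] by auto
    show ?thesis
    proof (cases "(x - y) \<bullet> u \<ge> 0")
      case True
      then show ?thesis using xy by (intro bexI[of _ x] bexI[of _ y]) auto
    next
      case False
      then show ?thesis using xy by (intro bexI[of _ y] bexI[of _ x]) (auto simp: inner_diff_left)
    qed
  qed
  obtain x e where x: "e > 0" "ball x e \<subseteq> W"
    using W(3) by (meson ex_in_conv mem_interior)
  obtain u :: 'a where u: "norm u = 1"
    using vector_choose_size[of 1] by auto
  have "x \<in> W" "x + (e/2) *\<^sub>R u \<in> W"
    using x u by (auto simp: subset_iff dist_norm)
  from le[OF u this(2,1)] have "w > 0"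
    using u x(1) by (simp add: dot_square_norm)
  with le attained show ?thesis using that by blast
qed

text \<open>If \<open>u\<close> is a unit normal at \<open>x\<close>, then the width in direction \<open>u\<close> is realised by \<open>x\<close> and some point
  \<open>y\<close>. The width \<open>w\<close> is also the diameter of the body, so \<open>y\<close> has no room to move sideways: it is
  \<open>x - w *\<^sub>R u\<close>. The points obtained in this way from two normals are again at most \<open>w\<close> apart, that is, two
  unit normals at \<open>x\<close> enclose an angle of at most 60 degrees.\<close>

lemma constant_width_normals:
  fixes W :: "'a::euclidean_space set"
  assumes "convex_body W" "constant_width W" "x \<in> W"
    and "u \<in> unit_normals W x" "v \<in> unit_normals W x"
  shows "u \<bullet> v \<ge> 1/2"
proof -
  obtain w where le: "\<And>u x y. norm u = 1 \<Longrightarrow> x \<in> W \<Longrightarrow> y \<in> W \<Longrightarrow> (x - y) \<bullet> u \<le> w"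
    and attained: "\<And>u. norm u = 1 \<Longrightarrow> \<exists>x\<in>W. \<exists>y\<in>W. (x - y) \<bullet> u = w"
    and "w > 0"
    using constant_width_inner[OF assms(1,2)] by blast
  have diam: "norm (y - z) \<le> w" if "y \<in> W" "z \<in> W" for y z
  proof (cases "y = z")
    case False
    have "(y - z) \<bullet> ((y - z) /\<^sub>R norm (y - z)) = norm (y - z)"
      using False by (simp add: dot_square_norm power2_eq_square)
    then show ?thesis
      using le[of "(y - z) /\<^sub>R norm (y - z)" y z] that False by simp
  qed (use \<open>w > 0\<close> in simp)
  have antipode: "x - w *\<^sub>R u \<in> W" if "u \<in> unit_normals W x" for u
  proof -
    have u: "norm u = 1" "\<And>y. y \<in> W \<Longrightarrow> y \<bullet> u \<le> x \<bullet> u"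
      using that by (auto simp: unit_normals_def)
    obtain p y where py: "p \<in> W" "y \<in> W" "(p - y) \<bullet> u = w"
      using attained[OF u(1)] by blast
    have "(x - y) \<bullet> u = w"
      using le[OF u(1) assms(3) py(2)] u(2)[OF py(1)] py(3) by (simp add: inner_diff_left)
    moreover have "(norm (x - y))\<^sup>2 \<le> w\<^sup>2"
      using diam[OF assms(3) py(2)] by (intro power_mono) auto
    ultimately have "(norm (x - y - w *\<^sub>R u))\<^sup>2 \<le> 0"
      using u(1) unfolding power2_norm_eq_inner
      by (simp add: inner_diff inner_commute power2_eq_square norm_eq_1 algebra_simps)
    then have "y = x - w *\<^sub>R u"
      by (simp add: algebra_simps)
    then show ?thesis using py by simp
  qed
  have "norm ((x - w *\<^sub>R u) - (x - w *\<^sub>R v)) \<le> w"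
    by (intro diam antipode assms)
  moreover have "(x - w *\<^sub>R u) - (x - w *\<^sub>R v) = w *\<^sub>R (v - u)"
    by (simp add: algebra_simps)
  ultimately have "norm (v - u) \<le> 1"
    using \<open>w > 0\<close> by simp
  then have "(norm (v - u))\<^sup>2 \<le> 1"
    by (simp add: power_le_one)
  then show ?thesis
    using assms(4,5) unfolding unit_normals_def power2_norm_eq_inner
    by (simp add: inner_diff inner_commute norm_eq_1)
qed

text \<open>A spherical form of Jung's theorem. The centre of the cap is the direction of the point \<open>p\<close> of least
  norm in the convex hull. By Caratheodory \<open>p\<close> is a convex combination of at most \<open>DIM('a) + 1\<close> of the
  vectors; expanding \<open>p \<bullet> p\<close>, the off-diagonal terms contribute at least \<open>1/2\<close> in the mean, and the
  diagonal ones an excess of half the sum of the squared coefficients.\<close>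

lemma jung_cap:
  fixes N :: "'a::euclidean_space set"
  assumes unit: "\<And>u. u \<in> N \<Longrightarrow> norm u = 1"
    and half: "\<And>u v. u \<in> N \<Longrightarrow> v \<in> N \<Longrightarrow> u \<bullet> v \<ge> 1/2"
    and "closed N"
  obtains v where "norm v = 1"
    and "\<And>u. u \<in> N \<Longrightarrow> u \<bullet> v > 0 \<and> (u \<bullet> v)\<^sup>2 \<ge> 1/2 + 1 / (2 * (DIM('a) + 1))"
proof (cases "N = {}")
  case True
  then show ?thesis using that vector_choose_size[of 1] by auto
next
  case False
  have "bounded N"
    using unit by (intro boundedI[of _ 1]) auto
  then have "compact (convex hull N)"
    using \<open>closed N\<close> compact_convex_hull compact_eq_bounded_closed by blast
  then have cl: "closed (convex hull N)"
    by (rule compact_imp_closed)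
  define p where "p = closest_point (convex hull N) 0"
  have p: "p \<in> convex hull N"
    unfolding p_def using cl False by (intro closest_point_in_set) auto
  have low: "u \<bullet> p \<ge> p \<bullet> p" if "u \<in> N" for u
    using closest_point_dot[OF convex_convex_hull cl, of u 0] that
    unfolding p_def[symmetric] by (auto simp: hull_inc inner_diff inner_commute)
  obtain S where S: "finite S" "S \<subseteq> N" "card S \<le> DIM('a) + 1" "p \<in> convex hull S"
    using p unfolding caratheodory[of N] by auto
  then obtain l where l: "\<And>u. u \<in> S \<Longrightarrow> l u \<ge> 0" "sum l S = 1" "(\<Sum>u\<in>S. l u *\<^sub>R u) = p"
    unfolding convex_hull_finite[OF S(1)] by auto
  have "card S > 0"
    using S(1) l(2) by (metis card_gt_0_iff sum.empty zero_neq_one)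
  have "1 \<le> real (card S) * (\<Sum>u\<in>S. (l u)\<^sup>2)"
    using sum_squared_le_sum_of_squares[of l S] l(2) S(1) by (simp add: mult.commute)
  also have "\<dots> \<le> (DIM('a) + 1) * (\<Sum>u\<in>S. (l u)\<^sup>2)"
    using S(3) by (intro mult_right_mono sum_nonneg) auto
  finally have sq: "(\<Sum>u\<in>S. (l u)\<^sup>2) \<ge> 1 / (DIM('a) + 1)"
    by (simp add: divide_simps mult.commute)
  have "p \<bullet> p = (\<Sum>u\<in>S. \<Sum>v\<in>S. l u * l v * (u \<bullet> v))"
    unfolding l(3)[symmetric] by (simp add: inner_sum_left inner_sum_right sum_distrib_left mult_ac inner_commute)
  also have "\<dots> \<ge> (\<Sum>u\<in>S. \<Sum>v\<in>S. l u * l v * (1/2 + of_bool (u = v) / 2))"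
  proof (intro sum_mono mult_left_mono)
    fix u v assume "u \<in> S" "v \<in> S"
    then have "u \<in> N" "v \<in> N" using S(2) by auto
    then show "1/2 + of_bool (u = v) / 2 \<le> u \<bullet> v"
      using half unit by (auto simp: dot_square_norm)
  qed (use l(1) in auto)
  also have "(\<Sum>u\<in>S. \<Sum>v\<in>S. l u * l v * (1/2 + of_bool (u = v) / 2))
      = (\<Sum>u\<in>S. \<Sum>v\<in>S. l u * l v) / 2 + (\<Sum>u\<in>S. (l u)\<^sup>2) / 2"
  proof -
    have "(\<Sum>v\<in>S. l u * l v * of_bool (u = v)) = (l u)\<^sup>2" if "u \<in> S" for u
    proof -
      have "(\<Sum>v\<in>S. l u * l v * of_bool (u = v)) = (\<Sum>v\<in>S. if v = u then (l u)\<^sup>2 else 0)"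
        by (intro sum.cong) (auto simp: power2_eq_square)
      then show ?thesis using that S(1) by simp
    qed
    then have "(\<Sum>u\<in>S. \<Sum>v\<in>S. l u * l v * of_bool (u = v)) = (\<Sum>u\<in>S. (l u)\<^sup>2)"
      by (rule sum.cong[OF refl])
    then show ?thesis
      by (simp add: distrib_left sum.distrib flip: sum_divide_distrib)
  qed
  also have "(\<Sum>u\<in>S. \<Sum>v\<in>S. l u * l v) = 1"
    using l(2) by (simp flip: sum_product)
  finally have "p \<bullet> p \<ge> 1/2 + 1 / (DIM('a) + 1) / 2"
    using divide_right_mono[OF sq, of 2] by simp
  then have pp: "p \<bullet> p \<ge> 1/2 + 1 / (2 * (DIM('a) + 1))"
    by (simp add: algebra_simps)
  moreover have "1/2 + 1 / (2 * (DIM('a) + 1)) > (0::real)"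
    by (intro add_pos_nonneg) auto
  ultimately have "p \<noteq> 0" by auto
  show ?thesis
  proof
    show "norm (p /\<^sub>R norm p) = 1" using \<open>p \<noteq> 0\<close> by simp
    fix u assume "u \<in> N"
    have "u \<bullet> (p /\<^sub>R norm p) \<ge> (p \<bullet> p) / norm p"
      using low[OF \<open>u \<in> N\<close>] by (simp add: divide_inverse mult.commute mult_left_mono)
    moreover have "(p \<bullet> p) / norm p = norm p"
      by (simp add: dot_square_norm power2_eq_square)
    ultimately have *: "u \<bullet> (p /\<^sub>R norm p) \<ge> norm p" by simp
    then have "(u \<bullet> (p /\<^sub>R norm p))\<^sup>2 \<ge> (norm p)\<^sup>2"
      by (intro power_mono) auto
    moreover have "(norm p)\<^sup>2 \<ge> 1/2 + 1 / (2 * (DIM('a) + 1))"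
      using pp by (simp add: dot_square_norm)
    moreover have "0 < norm p" using \<open>p \<noteq> 0\<close> by simp
    ultimately show "u \<bullet> (p /\<^sub>R norm p) > 0 \<and>
        (u \<bullet> (p /\<^sub>R norm p))\<^sup>2 \<ge> 1/2 + 1 / (2 * (DIM('a) + 1))"
      using * by (intro conjI) linarith+
  qed
qed

text \<open>A ray from \<open>x\<close> that misses the interior can be separated from it; the separating hyperplane passes
  through \<open>x\<close>, and its normal vector makes an angle of at most 90 degrees with the ray.\<close>

lemma illuminated_if_obtuse:
  fixes K :: "'a::euclidean_space set"
  assumes "convex_body K" "x \<in> K" and obtuse: "\<And>u. u \<in> unit_normals K x \<Longrightarrow> e \<bullet> u < 0"
  shows "illuminated_along K x e"
proof (rule ccontr)
  assume not: "\<not> illuminated_along K x e"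
  let ?R = "{x + t *\<^sub>R e |t. t \<ge> 0}"
  have K: "convex K" "closed K" "interior K \<noteq> {}"
    using assms(1) by (auto simp: convex_body_def compact_imp_closed)
  have "convex ?R"
  proof (rule convexI)
    fix y z and a b :: real
    assume "y \<in> ?R" "z \<in> ?R" and ab: "0 \<le> a" "0 \<le> b" "a + b = 1"
    then obtain s t where "s \<ge> 0" "t \<ge> 0" "y = x + s *\<^sub>R e" "z = x + t *\<^sub>R e" by auto
    moreover have "a *\<^sub>R (x + s *\<^sub>R e) + b *\<^sub>R (x + t *\<^sub>R e) = (a + b) *\<^sub>R x + (a * s + b * t) *\<^sub>R e"
      by (simp add: algebra_simps)
    ultimately show "a *\<^sub>R y + b *\<^sub>R z \<in> ?R"
      using ab by (intro CollectI exI[of _ "a * s + b * t"]) auto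
  qed
  moreover have "?R \<noteq> {}" by auto
  moreover have "interior K \<inter> ?R = {}"
    using not unfolding illuminated_along_def by auto
  ultimately obtain a b where ab: "a \<noteq> 0" "\<forall>y\<in>interior K. a \<bullet> y \<le> b" "\<forall>y\<in>?R. b \<le> a \<bullet> y"
    using separating_hyperplane_sets[OF convex_interior[OF K(1)], of ?R] K(3) by auto
  have "interior K \<subseteq> {y. a \<bullet> y \<le> b}"
    using ab(2) by auto
  then have "closure (interior K) \<subseteq> {y. a \<bullet> y \<le> b}"
    by (rule closure_minimal) (rule closed_halfspace_le)
  then have below: "a \<bullet> y \<le> b" if "y \<in> K" for y
    using that convex_closure_interior[OF K(1,3)] closure_closed[OF K(2)] by auto
  have "x \<in> ?R" by (intro CollectI exI[of _ 0]) auto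
  then have "a \<bullet> x = b" using ab(3) below[OF \<open>x \<in> K\<close>] by force
  have "x + e \<in> ?R" by (intro CollectI exI[of _ 1]) auto
  then have "a \<bullet> e \<ge> 0"
    using ab(3) \<open>a \<bullet> x = b\<close> by (force simp: inner_add_right)
  have "a /\<^sub>R norm a \<in> unit_normals K x"
    using below \<open>a \<bullet> x = b\<close> ab(1)
    by (auto simp: unit_normals_def inner_commute intro: mult_left_mono)
  from obtuse[OF this] show False
    using \<open>a \<bullet> e \<ge> 0\<close> by (simp add: inner_commute mult_less_0_iff)
qed

text \<open>All the normals at \<open>x\<close> lie in a cap around some unit vector; let \<open>v\<close> be its antipode. The radius of this cap
  and the angle whose cosine is the bound below are complementary, so a direction that is closer than that
  angle to \<open>v\<close> is at an obtuse angle to every normal. Illuminating \<open>W\<close> has thereby become a matter of covering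
  the sphere by caps around the chosen directions.\<close>

lemma constant_width_illumination_axis:
  fixes W :: "'a::euclidean_space set"
  assumes "convex_body W" "constant_width W" "x \<in> W"
  obtains v where "norm v = 1"
    and "\<And>e. norm e = 1 \<Longrightarrow> e \<bullet> v > sqrt (DIM('a) / (2 * (DIM('a) + 1)))
              \<Longrightarrow> illuminated_along W x e"
proof -
  let ?n = "real DIM('a)"
  have "closed (unit_normals W x)"
  proof -
    have "unit_normals W x = sphere 0 1 \<inter> (\<Inter>y\<in>W. {u. y \<bullet> u \<le> x \<bullet> u})"
      by (auto simp: unit_normals_def)
    then show ?thesis
      by (auto intro!: closed_Int closed_INT closed_Collect_le continuous_intros)
  qed
  then obtain v where v: "norm v = 1"
      "\<And>u. u \<in> unit_normals W x \<Longrightarrow> u \<bullet> v > 0 \<and> (u \<bullet> v)\<^sup>2 \<ge> 1/2 + 1 / (2 * (DIM('a) + 1))"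
    using jung_cap[of "unit_normals W x"] constant_width_normals[OF assms]
    by (auto simp: unit_normals_def)
  show ?thesis
  proof
    show "norm (- v) = 1" using v by simp
    fix e :: 'a assume e: "norm e = 1" "e \<bullet> - v > sqrt (?n / (2 * (DIM('a) + 1)))"
    show "illuminated_along W x e"
    proof (rule illuminated_if_obtuse[OF assms(1,3)])
      fix u assume u: "u \<in> unit_normals W x"
      define \<alpha> \<beta> where "\<alpha> = u \<bullet> v" and "\<beta> = - (e \<bullet> v)"
      have \<alpha>: "\<alpha> > 0" "\<alpha>\<^sup>2 \<ge> 1/2 + 1 / (2 * (?n + 1))"
        using v(2)[OF u] by (auto simp: \<alpha>_def add.commute)
      have "sqrt (?n / (2 * (?n + 1))) \<ge> 0" by simp
      moreover have "\<beta> > sqrt (?n / (2 * (?n + 1)))"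
        using e(2) by (simp add: \<beta>_def add.commute)
      ultimately have \<beta>: "\<beta> > sqrt (?n / (2 * (?n + 1)))" "\<beta> > 0"
        by linarith+
      then have "\<beta>\<^sup>2 > (sqrt (?n / (2 * (?n + 1))))\<^sup>2"
        by (intro power_strict_mono) auto
      then have "\<beta>\<^sup>2 > ?n / (2 * (?n + 1))"
        by simp
      moreover have "1 / (2 * (?n + 1)) + ?n / (2 * (?n + 1)) = 1/2"
        unfolding add_divide_distrib[symmetric] by (subst nonzero_divide_eq_eq) auto
      ultimately have big: "\<alpha>\<^sup>2 + \<beta>\<^sup>2 > 1" using \<alpha>(2) by linarith
      show "e \<bullet> u < 0"
      proof (rule ccontr)
        assume "\<not> e \<bullet> u < 0"
        then have "2 * \<alpha> * \<beta> * (e \<bullet> u) \<ge> 0" using \<alpha>(1) \<beta>(2) by simp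
        \<comment> \<open>If \<open>u\<close> and \<open>- e\<close> enclosed an angle of at least 90 degrees, then \<open>v\<close>, being close to both of them,
          would violate Bessel's inequality.\<close>
        define q where "q = \<alpha> *\<^sub>R u - \<beta> *\<^sub>R e"
        have "q \<bullet> v = \<alpha>\<^sup>2 + \<beta>\<^sup>2"
          by (simp add: q_def inner_diff_left inner_add_left \<alpha>_def \<beta>_def power2_eq_square)
        moreover have "q \<bullet> q \<le> \<alpha>\<^sup>2 + \<beta>\<^sup>2"
        proof -
          have "u \<bullet> u = 1" "e \<bullet> e = 1"
            using u e(1) by (auto simp: unit_normals_def norm_eq_1)
          then have "q \<bullet> q = \<alpha>\<^sup>2 + \<beta>\<^sup>2 - 2 * \<alpha> * \<beta> * (e \<bullet> u)"
            by (simp add: q_def inner_diff inner_commute power2_eq_square algebra_simps)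
          with \<open>2 * \<alpha> * \<beta> * (e \<bullet> u) \<ge> 0\<close> show ?thesis by linarith
        qed
        moreover have "(q \<bullet> v)\<^sup>2 \<le> (q \<bullet> q) * (v \<bullet> v)"
          by (rule Cauchy_Schwarz_ineq)
        moreover have "v \<bullet> v = 1" using v(1) by (simp add: norm_eq_1)
        ultimately have "(\<alpha>\<^sup>2 + \<beta>\<^sup>2)\<^sup>2 \<le> \<alpha>\<^sup>2 + \<beta>\<^sup>2" by simp
        then show False
          using big mult_strict_left_mono[OF big, of "\<alpha>\<^sup>2 + \<beta>\<^sup>2"]
          by (simp add: power2_eq_square[of "\<alpha>\<^sup>2 + \<beta>\<^sup>2"])
      qed
    qed
  qed
qed

section \<open>Sign vectors\<close>

lemma decreasing_enumeration:
  fixes f :: "'n::finite \<Rightarrow> real"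
  obtains \<pi> where "bij_betw \<pi> {..<CARD('n)} UNIV"
    and "\<And>i l. i \<le> l \<Longrightarrow> l < CARD('n) \<Longrightarrow> f (\<pi> l) \<le> f (\<pi> i)"
proof -
  obtain xs :: "'n list" where xs: "set xs = UNIV" "distinct xs"
    using finite_distinct_list[of "UNIV :: 'n set"] by auto
  define ys where "ys = sort_key (\<lambda>i. - f i) xs"
  have ys: "set ys = UNIV" "distinct ys" "length ys = CARD('n)"
    using xs distinct_card[of xs] by (auto simp: ys_def)
  have "sorted (map (\<lambda>i. - f i) ys)"
    by (simp add: ys_def)
  then have "f (ys ! l) \<le> f (ys ! i)" if "i \<le> l" "l < CARD('n)" for i l
    using sorted_nth_mono[of "map (\<lambda>i. - f i) ys" i l] that ys(3) by simp
  moreover have "bij_betw ((!) ys) {..<CARD('n)} UNIV"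
    using ys by (intro bij_betw_nth) auto
  ultimately show ?thesis using that by blast
qed

lemma sum_decreasing_ge_last:
  fixes b :: "nat \<Rightarrow> real"
  assumes mono: "\<And>i l. i \<le> l \<Longrightarrow> l < m \<Longrightarrow> b l \<le> b i"
    and S: "S \<subseteq> {..<m}" "card S = m - k" and "k < m"
  shows "(\<Sum>i=k..<m. b i) \<le> sum b S"
proof -
  have fin: "finite S" using S(1) finite_subset by auto
  let ?T = "{k..<m}"
  have "card S = card ?T" using S(2) by simp
  then have c: "card (S - ?T) = card (?T - S)"
    using fin by (intro card_le_sym_Diff antisym) auto
  have "sum b (?T - S) \<le> card (?T - S) * b k"
    using sum_bounded_above[of "?T - S" b "b k"] mono by auto
  also have "\<dots> \<le> sum b (S - ?T)"
    using sum_bounded_below[of "S - ?T" "b k" b] mono \<open>k < m\<close> S(1) c by fastforce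
  finally have "sum b (?T - S) + sum b (?T \<inter> S) \<le> sum b (S - ?T) + sum b (S \<inter> ?T)"
    by (simp add: Int_commute)
  then show ?thesis
    using sum.Int_Diff[of ?T b S] sum.Int_Diff[of S b ?T] fin by simp
qed

text \<open>The set \<open>T\<close> marks the negative entries. Only its trace on the support \<open>S\<close> matters.\<close>

definition sign_vec :: "'n::finite set \<Rightarrow> 'n set \<Rightarrow> real ^ 'n" where
  "sign_vec S T = (\<chi> i. if i \<in> S then (if i \<in> T then -1 else 1) / sqrt (card S) else 0)"

lemma norm_sign_vec:
  assumes "S \<noteq> {}"
  shows "norm (sign_vec S T) = 1"
proof -
  have "sign_vec S T \<bullet> sign_vec S T = (\<Sum>i\<in>UNIV. if i \<in> S then 1 / card S else 0)"
    unfolding sign_vec_def inner_vec_def by (intro sum.cong) auto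
  also have "\<dots> = 1"
    using assms by (simp add: sum.If_cases)
  finally show ?thesis by (simp add: norm_eq_1)
qed

lemma inner_sign_vec:
  "sign_vec S T \<bullet> v = (\<Sum>i\<in>S. (if i \<in> T then -1 else 1) * v $ i) / sqrt (card S)"
proof -
  have "sign_vec S T \<bullet> v =
      (\<Sum>i\<in>UNIV. if i \<in> S then (if i \<in> T then -1 else 1) * v $ i / sqrt (card S) else 0)"
    unfolding sign_vec_def inner_vec_def by (intro sum.cong) auto
  then show ?thesis
    by (simp add: sum.If_cases sum_divide_distrib)
qed

lemma uminus_sign_vec: "- sign_vec S T = sign_vec S (S - T)"
  by (auto simp: sign_vec_def vec_eq_iff)

definition sign_vecs :: "'n::finite set set \<Rightarrow> (real ^ 'n) set" where
  "sign_vecs \<S> = (\<Union>S\<in>\<S>. sign_vec S ` Pow S)"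

definition half_cube :: "(real ^ 'n::finite) set" where
  "half_cube = sign_vec UNIV ` {T. even (card T)}"

lemma sign_vecs_inner:
  assumes "S \<in> \<S>"
  shows "\<exists>e\<in>sign_vecs \<S>. e \<bullet> v = (\<Sum>i\<in>S. \<bar>v $ i\<bar>) / sqrt (card S)"
proof (rule bexI)
  let ?T = "{i \<in> S. v $ i < 0}"
  show "sign_vec S ?T \<in> sign_vecs \<S>" using assms by (auto simp: sign_vecs_def)
  show "sign_vec S ?T \<bullet> v = (\<Sum>i\<in>S. \<bar>v $ i\<bar>) / sqrt (card S)"
    unfolding inner_sign_vec by (intro arg_cong2[where f = "(/)"] sum.cong) auto
qed

text \<open>If the sign pattern of \<open>v\<close> has the wrong parity, it is corrected at the coordinate \<open>j\<close>. The estimate is used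
  for a coordinate of least absolute value.\<close>

lemma half_cube_inner:
  fixes v :: "real ^ 'n"
  shows "\<exists>e\<in>half_cube. e \<bullet> v \<ge> ((\<Sum>i\<in>UNIV. \<bar>v $ i\<bar>) - 2 * \<bar>v $ j\<bar>) / sqrt (CARD('n))"
proof -
  define T where "T = {i. v $ i < 0}"
  define T' where "T' = (if even (card T) then T else if j \<in> T then T - {j} else insert j T)"
  have "even (card T')"
    by (auto simp: T'_def card_insert_if card_gt_0_iff)
  then have "sign_vec UNIV T' \<in> half_cube" by (simp add: half_cube_def)
  moreover have "(\<Sum>i\<in>UNIV. \<bar>v $ i\<bar> - (if i = j then 2 * \<bar>v $ j\<bar> else 0))
      \<le> (\<Sum>i\<in>UNIV. (if i \<in> T' then -1 else 1) * v $ i)"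
    by (intro sum_mono) (auto simp: T'_def T_def)
  then have "(\<Sum>i\<in>UNIV. \<bar>v $ i\<bar>) - 2 * \<bar>v $ j\<bar> \<le> (\<Sum>i\<in>UNIV. (if i \<in> T' then -1 else 1) * v $ i)"
    by (simp add: sum_subtractf)
  then have "sign_vec UNIV T' \<bullet> v \<ge> ((\<Sum>i\<in>UNIV. \<bar>v $ i\<bar>) - 2 * \<bar>v $ j\<bar>) / sqrt (CARD('n))"
    unfolding inner_sign_vec by (intro divide_right_mono) auto
  ultimately show ?thesis by blast
qed

text \<open>A set of even size is determined by its trace on the complement of any fixed point.\<close>

lemma card_half_cube: "card (half_cube :: (real ^ 'n::finite) set) \<le> 2 ^ (CARD('n) - 1)"
proof -
  obtain a :: 'n where True by simp
  have "inj_on (\<lambda>T. T - {a}) {T :: 'n set. even (card T)}"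
  proof (rule inj_onI)
    fix T U :: "'n set"
    assume "T \<in> {T. even (card T)}" "U \<in> {T. even (card T)}" and eq: "T - {a} = U - {a}"
    then have "even (card T)" "even (card U)" by auto
    moreover have "card V = card (V - {a}) + of_bool (a \<in> V)" for V :: "'n set"
      by (cases "a \<in> V") (auto simp: card_Suc_Diff1 simp del: card_Diff_insert)
    ultimately have "even (card (U - {a}) + of_bool (a \<in> T))" "even (card (U - {a}) + of_bool (a \<in> U))"
      using eq by metis+
    then have "a \<in> T \<longleftrightarrow> a \<in> U"
      by (cases "a \<in> T"; cases "a \<in> U") simp_all
    with eq show "T = U" by blast
  qed
  then have "card {T :: 'n set. even (card T)} \<le> card (Pow (UNIV - {a}))"
    by (rule card_inj_on_le) auto
  also have "\<dots> = 2 ^ (CARD('n) - 1)"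
    by (simp add: card_Pow card_Diff_singleton)
  finally show ?thesis
    unfolding half_cube_def by (meson card_image_le finite le_trans)
qed

lemma card_sign_vecs_le:
  "card (sign_vecs \<S>) \<le> (\<Sum>S\<in>\<S>. 2 ^ card S)"
proof -
  have "card (sign_vecs \<S>) \<le> (\<Sum>S\<in>\<S>. card (sign_vec S ` Pow S))"
    unfolding sign_vecs_def by (rule card_UN_le) simp
  also have "\<dots> \<le> (\<Sum>S\<in>\<S>. card (Pow S))"
    by (intro sum_mono card_image_le) simp
  finally show ?thesis by (simp add: card_Pow)
qed

section \<open>Decreasing sequences with bounded partial sums\<close>

text \<open>Here \<open>b\<close> stands for the decreasingly ordered absolute values of the coordinates of a vector. The squares of
  all the terms from index \<open>j\<close> on are replaced by something linear in the remaining budget \<open>N - (\<Sum>i<j. b i)\<close>.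
  All these terms lie between the last one, \<open>z\<close>, and \<open>\<sigma> = b j\<close>, so each square is at most the chord
  \<open>(\<sigma> + z) * b i - \<sigma> * z\<close>. If \<open>z\<close> is small, this gives \<open>\<sigma>\<close> times the budget, as if the tail were
  \<open>\<sigma>, \<dots>, \<sigma>, 0, \<dots>, 0\<close>. Because the last term enters the total with a negative sign, there is a second extremal
  shape: a constant tail \<open>t, \<dots>, t\<close>, of total \<open>(n - j - 2) * t\<close>.\<close>

lemma tail_bound:
  fixes b :: "nat \<Rightarrow> real"
  assumes mono: "\<And>i l. i \<le> l \<Longrightarrow> l < n \<Longrightarrow> b l \<le> b i"
    and nonneg: "\<And>i. i < n \<Longrightarrow> 0 \<le> b i"
    and "j + 2 < n" and total: "(\<Sum>i<n. b i) - 2 * b (n - 1) \<le> N"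
  shows "(\<Sum>i<n. (b i)\<^sup>2) \<le> (\<Sum>i<j. (b i)\<^sup>2) + b j * (N - (\<Sum>i<j. b i)) \<or>
    (\<exists>t. 0 \<le> t \<and> t \<le> b j \<and> (\<Sum>i<j. b i) + real (n - j - 2) * t \<le> N \<and>
      (\<Sum>i<n. (b i)\<^sup>2) \<le> (\<Sum>i<j. (b i)\<^sup>2) + t * (N + 2 * t - (\<Sum>i<j. b i)))"
proof -
  define m s z \<sigma> Q where "m = n - 1" and "s = (\<Sum>i<j. b i)" and "z = b m"
    and "\<sigma> = b j" and "Q = (\<Sum>i=j..<m. b i) - z"
  define \<nu> where "\<nu> = real (n - j - 2)"
  have n: "n = Suc m" "j < m" and \<nu>: "real (m - j) = \<nu> + 1" "\<nu> \<ge> 1"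
    using \<open>j + 2 < n\<close> by (auto simp: m_def \<nu>_def)
  have split: "(\<Sum>i<n. f i) = (\<Sum>i<j. f i) + (\<Sum>i=j..<m. f i) + f m" for f :: "nat \<Rightarrow> real"
  proof -
    have "(\<Sum>i<m. f i) = (\<Sum>i<j. f i) + (\<Sum>i=j..<m. f i)"
      using n(2) sum.atLeastLessThan_concat[of 0 j m f] by (simp add: atLeast0LessThan)
    then show ?thesis by (simp add: n(1))
  qed
  have z: "0 \<le> z" "z \<le> \<sigma>"
    using nonneg[of m] mono[of j m] n by (auto simp: z_def \<sigma>_def)
  have "s + Q \<le> N"
    using total unfolding split s_def Q_def z_def m_def by simp
  have "(\<nu> + 1) * z \<le> (\<Sum>i=j..<m. b i)"
    using sum_bounded_below[of "{j..<m}" z b] mono n \<nu>(1) by (auto simp: z_def)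
  then have Q: "\<nu> * z \<le> Q"
    unfolding Q_def by (simp add: algebra_simps)
  have "(\<Sum>i=j..<m. (b i)\<^sup>2) \<le> (\<Sum>i=j..<m. (\<sigma> + z) * b i - \<sigma> * z)"
  proof (rule sum_mono)
    fix i assume "i \<in> {j..<m}"
    then have "0 \<le> (\<sigma> - b i) * (b i - z)"
      using mono[of j i] mono[of i m] n by (intro mult_nonneg_nonneg) (auto simp: z_def \<sigma>_def)
    then show "(b i)\<^sup>2 \<le> (\<sigma> + z) * b i - \<sigma> * z"
      by (simp add: algebra_simps power2_eq_square)
  qed
  also have "\<dots> = (\<sigma> + z) * (Q + z) - (\<nu> + 1) * (\<sigma> * z)"
    using \<nu>(1) by (simp add: sum_subtractf Q_def flip: sum_distrib_left)
  finally have tail: "(\<Sum>i=j..<m. (b i)\<^sup>2) + z\<^sup>2 \<le> \<sigma> * Q + z * (Q + 2 * z - \<nu> * \<sigma>)"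
    by (simp add: algebra_simps power2_eq_square)
  show ?thesis
  proof (cases "z * (Q + 2 * z - \<nu> * \<sigma>) \<le> 0")
    case True
    have "\<sigma> * Q \<le> \<sigma> * (N - s)"
      using \<open>s + Q \<le> N\<close> z by (intro mult_left_mono) auto
    then have "(\<Sum>i<n. (b i)\<^sup>2) \<le> (\<Sum>i<j. (b i)\<^sup>2) + \<sigma> * (N - s)"
      using True tail unfolding split z_def by linarith
    then show ?thesis by (simp add: s_def \<sigma>_def)
  next
    case False
    then have pos: "0 < z" "0 < Q + 2 * z - \<nu> * \<sigma>"
      using z(1) by (auto simp: not_le zero_less_mult_iff)
    \<comment> \<open>The largest admissible value for a constant tail; the claim is that a constant tail is extremal.\<close>
    define t where "t = min \<sigma> (Q / \<nu>)"
    have t: "t \<le> \<sigma>" "\<nu> * t \<le> Q" "z \<le> t"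
      using \<nu>(2) z Q by (auto simp: t_def min_def field_simps)
    have "(\<Sum>i=j..<m. (b i)\<^sup>2) + z\<^sup>2 \<le> (\<nu> + 2) * t\<^sup>2"
    proof (cases "t = \<sigma>")
      case True
      have "(\<Sum>i=j..<m. (b i)\<^sup>2) \<le> (\<nu> + 1) * \<sigma>\<^sup>2"
        using sum_bounded_above[of "{j..<m}" "\<lambda>i. (b i)\<^sup>2" "\<sigma>\<^sup>2"] mono nonneg n \<nu>(1)
        by (auto simp: \<sigma>_def intro!: power_mono)
      moreover have "z\<^sup>2 \<le> \<sigma>\<^sup>2" using z by (intro power_mono)
      ultimately show ?thesis unfolding True by (simp add: algebra_simps)
    next
      case False
      then have Qt: "Q = \<nu> * t" using \<nu>(2) by (auto simp: t_def min_def split: if_splits)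
      have "\<nu> * t - \<nu> * \<sigma> + 2 * z \<le> (\<nu> + 2) * t + 2 * z - \<nu> * \<sigma>"
        using t z by (simp add: algebra_simps)
      then have "0 \<le> (t - z) * ((\<nu> + 2) * t + 2 * z - \<nu> * \<sigma>)"
        using pos(2) t(3) unfolding Qt by (intro mult_nonneg_nonneg) auto
      then show ?thesis
        using tail unfolding Qt by (simp add: algebra_simps power2_eq_square)
    qed
    moreover have "t * (\<nu> * t) \<le> t * (N - s)"
      using t z \<open>s + Q \<le> N\<close> by (intro mult_left_mono) auto
    ultimately have "(\<Sum>i<n. (b i)\<^sup>2) \<le> (\<Sum>i<j. (b i)\<^sup>2) + t * (N + 2 * t - s)"
      unfolding split z_def by (simp add: algebra_simps power2_eq_square)
    moreover have "s + \<nu> * t \<le> N" using t \<open>s + Q \<le> N\<close> by linarith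
    moreover have "0 \<le> t" using t z by linarith
    ultimately show ?thesis
      using t(1) unfolding s_def \<sigma>_def \<nu>_def by blast
  qed
qed

text \<open>The form in which the dichotomy is applied: \<open>\<nu>\<close> may be chosen for the smallest of several dimensions.\<close>

lemma tail_bound_le:
  fixes b :: "nat \<Rightarrow> real"
  assumes "\<And>i l. i \<le> l \<Longrightarrow> l < n \<Longrightarrow> b l \<le> b i" "\<And>i. i < n \<Longrightarrow> 0 \<le> b i"
    and "j + 2 < n" "(\<Sum>i<n. b i) - 2 * b (n - 1) \<le> N"
    and "\<nu> \<le> n - j - 2"
    and A: "\<And>t. 0 \<le> t \<Longrightarrow> t \<le> b j \<Longrightarrow> (\<Sum>i<j. (b i)\<^sup>2) + t * (N - (\<Sum>i<j. b i)) \<le> C"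
    and B: "\<And>t. 0 \<le> t \<Longrightarrow> t \<le> b j \<Longrightarrow> (\<Sum>i<j. b i) + real \<nu> * t \<le> N \<Longrightarrow>
      (\<Sum>i<j. (b i)\<^sup>2) + t * (N + 2 * t - (\<Sum>i<j. b i)) \<le> C"
  shows "(\<Sum>i<n. (b i)\<^sup>2) \<le> C"
proof -
  have "(\<Sum>i<n. (b i)\<^sup>2) \<le> (\<Sum>i<j. (b i)\<^sup>2) + b j * (N - (\<Sum>i<j. b i)) \<or>
    (\<exists>t. 0 \<le> t \<and> t \<le> b j \<and> (\<Sum>i<j. b i) + real (n - j - 2) * t \<le> N \<and>
      (\<Sum>i<n. (b i)\<^sup>2) \<le> (\<Sum>i<j. (b i)\<^sup>2) + t * (N + 2 * t - (\<Sum>i<j. b i)))"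
    by (rule tail_bound) (use assms(1-4) in auto)
  then show ?thesis
  proof (elim disjE exE conjE)
    assume "(\<Sum>i<n. (b i)\<^sup>2) \<le> (\<Sum>i<j. (b i)\<^sup>2) + b j * (N - (\<Sum>i<j. b i))"
    also have "\<dots> \<le> C" using assms(2,3) by (intro A) auto
    finally show ?thesis .
  next
    fix t assume t: "0 \<le> t" "t \<le> b j" "(\<Sum>i<j. b i) + real (n - j - 2) * t \<le> N"
      and "(\<Sum>i<n. (b i)\<^sup>2) \<le> (\<Sum>i<j. (b i)\<^sup>2) + t * (N + 2 * t - (\<Sum>i<j. b i))"
    note this(4)
    also have "real \<nu> * t \<le> real (n - j - 2) * t"
      using \<open>0 \<le> t\<close> \<open>\<nu> \<le> n - j - 2\<close> by (intro mult_right_mono) auto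
    then have "(\<Sum>i<j. (b i)\<^sup>2) + t * (N + 2 * t - (\<Sum>i<j. b i)) \<le> C"
      using t by (intro B) auto
    finally show ?thesis .
  qed
qed

text \<open>Summation by parts: with \<open>d\<^sub>l = b\<^sub>l - b\<^sub>l\<^sub>+\<^sub>1 \<ge> 0\<close> (the last step going down to \<open>t\<close>), the sum of
  the squares is the sum of \<open>d\<^sub>l\<close> times the partial sums \<open>b\<^sub>0 + \<dots> + b\<^sub>l\<close>, plus \<open>t\<close> times the full
  sum. Replacing every partial sum by a constant upper bound \<open>u\<^sub>l\<close> makes the quadratic form linear.\<close>

lemma abel_2:
  fixes b0 b1 t w u0 u1 :: real
  assumes "b1 \<le> b0" "t \<le> b1"
    and "b0 \<le> u0" "b0 + b1 \<le> u1"
  shows "b0\<^sup>2 + b1\<^sup>2 + t * (w - (b0 + b1))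
    \<le> (b0 - b1) * u0 + (b1 - t) * u1 + t * w"
proof -
  have "0 \<le> (b0 - b1) * (u0 - b0) + (b1 - t) * (u1 - (b0 + b1))"
    using assms by (intro add_nonneg_nonneg mult_nonneg_nonneg) (simp_all only: diff_ge_0_iff_ge)
  then show ?thesis by (simp add: algebra_simps power2_eq_square)
qed

lemma abel_3:
  fixes b0 b1 b2 t w u0 u1 u2 :: real
  assumes "b1 \<le> b0" "b2 \<le> b1" "t \<le> b2"
    and "b0 \<le> u0" "b0 + b1 \<le> u1" "b0 + b1 + b2 \<le> u2"
  shows "b0\<^sup>2 + b1\<^sup>2 + b2\<^sup>2 + t * (w - (b0 + b1 + b2))
    \<le> (b0 - b1) * u0 + (b1 - b2) * u1 + (b2 - t) * u2 + t * w"
proof -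
  have "0 \<le> (b0 - b1) * (u0 - b0) + (b1 - b2) * (u1 - (b0 + b1)) + (b2 - t) * (u2 - (b0 + b1 + b2))"
    using assms by (intro add_nonneg_nonneg mult_nonneg_nonneg) (simp_all only: diff_ge_0_iff_ge)
  then show ?thesis by (simp add: algebra_simps power2_eq_square)
qed

lemma abel_4:
  fixes b0 b1 b2 b3 t w u0 u1 u2 u3 :: real
  assumes "b1 \<le> b0" "b2 \<le> b1" "b3 \<le> b2" "t \<le> b3"
    and "b0 \<le> u0" "b0 + b1 \<le> u1" "b0 + b1 + b2 \<le> u2" "b0 + b1 + b2 + b3 \<le> u3"
  shows "b0\<^sup>2 + b1\<^sup>2 + b2\<^sup>2 + b3\<^sup>2 + t * (w - (b0 + b1 + b2 + b3))
    \<le> (b0 - b1) * u0 + (b1 - b2) * u1 + (b2 - b3) * u2 + (b3 - t) * u3 + t * w"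
proof -
  have "0 \<le> (b0 - b1) * (u0 - b0) + (b1 - b2) * (u1 - (b0 + b1)) + (b2 - b3) * (u2 - (b0 + b1 + b2)) +
      (b3 - t) * (u3 - (b0 + b1 + b2 + b3))"
    using assms by (intro add_nonneg_nonneg mult_nonneg_nonneg) (simp_all only: diff_ge_0_iff_ge)
  then show ?thesis by (simp add: algebra_simps power2_eq_square)
qed

lemma abel_6:
  fixes b0 b1 b2 b3 b4 b5 t w u0 u1 u2 u3 u4 u5 :: real
  assumes "b1 \<le> b0" "b2 \<le> b1" "b3 \<le> b2" "b4 \<le> b3" "b5 \<le> b4" "t \<le> b5"
    and "b0 \<le> u0" "b0 + b1 \<le> u1" "b0 + b1 + b2 \<le> u2" "b0 + b1 + b2 + b3 \<le> u3"
      "b0 + b1 + b2 + b3 + b4 \<le> u4" "b0 + b1 + b2 + b3 + b4 + b5 \<le> u5"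
  shows "b0\<^sup>2 + b1\<^sup>2 + b2\<^sup>2 + b3\<^sup>2 + b4\<^sup>2 + b5\<^sup>2 + t * (w - (b0 + b1 + b2 + b3 + b4 + b5))
    \<le> (b0 - b1) * u0 + (b1 - b2) * u1 + (b2 - b3) * u2 + (b3 - b4) * u3 + (b4 - b5) * u4 +
      (b5 - t) * u5 + t * w"
proof -
  have "0 \<le> (b0 - b1) * (u0 - b0) + (b1 - b2) * (u1 - (b0 + b1)) + (b2 - b3) * (u2 - (b0 + b1 + b2)) +
      (b3 - b4) * (u3 - (b0 + b1 + b2 + b3)) + (b4 - b5) * (u4 - (b0 + b1 + b2 + b3 + b4)) +
      (b5 - t) * (u5 - (b0 + b1 + b2 + b3 + b4 + b5))"
    using assms by (intro add_nonneg_nonneg mult_nonneg_nonneg) (simp_all only: diff_ge_0_iff_ge)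
  then show ?thesis by (simp add: algebra_simps power2_eq_square)
qed

text \<open>The five lemmas below bound, for dimensions with the same \<open>n div 4\<close> and the same choice of supports,
  the two expressions to which \<open>tail_bound_le\<close> reduces the sum of squares. The constants \<open>1.4143\<close> and
  \<open>1.7321\<close> stand for \<open>sqrt 2\<close> and \<open>sqrt 3\<close>, the total stands for the square root of the larger dimension,
  and the bound on the right is just below \<open>2 * (n + 1) / n\<close> for that dimension. Each proof
  passes to the differences \<open>d\<^sub>l\<close>, linearises with constants \<open>u\<^sub>l\<close> which are (rounded) maxima of the
  partial sums under the given constraints, and leaves a linear inequality in nonnegative variables.
  The weight \<open>N + 2 * t\<close> of the second expression is bounded by using that all the entries are at
  least \<open>t\<close>, which forces \<open>t\<close> to be at most \<open>N / (n - 2)\<close> where \<open>n\<close> is the smaller dimension.\<close>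

lemma profile_dim_7:
  fixes b0 b1 t :: real
  assumes sorted: "b1 \<le> b0" "t \<le> b1"
    and "0 \<le> t"
    and bounds: "b0 \<le> 1" "b1 + t \<le> 14143/10000"
  shows "b0\<^sup>2 + b1\<^sup>2 + t * (26458/10000 - (b0 + b1)) \<le> 2285/1000"
    and "b0 + b1 + 3 * t \<le> 26458/10000 \<Longrightarrow>
      b0\<^sup>2 + b1\<^sup>2 + t * (26458/10000 + 2 * t - (b0 + b1)) \<le> 2285/1000"
proof -
  define d0 d1 where
    "d0 = b0 - b1" and "d1 = b1 - t"
  note d_defs = d0_def d1_def
  have b: "b0 = d0 + d1 + t" "b1 = d1 + t"
    by (simp_all add: d_defs)
  have "0 \<le> d0" "0 \<le> d1"
    using sorted by (auto simp: d_defs)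
  note lin = this bounds[unfolded b] \<open>0 \<le> t\<close>
  note abel = abel_2[OF sorted, folded d_defs]
  show "b0\<^sup>2 + b1\<^sup>2 + t * (26458/10000 - (b0 + b1)) \<le> 2285/1000"
  proof -
    have "b0\<^sup>2 + b1\<^sup>2 + t * (26458/10000 - (b0 + b1))
        \<le> d0 * 1 + d1 * 2 + t * (26458/10000)"
      by (rule abel) (use lin in \<open>simp_all add: b\<close>)
    also have "\<dots> \<le> 2285/1000"
      using lin by simp
    finally show ?thesis .
  qed
  \<comment> \<open>A large \<open>t\<close> makes the weight \<open>N + 2 * t\<close> large but, through the total, the partial sum \<open>b0 + b1\<close>
    small; the value \<open>0.3\<close> separates the two regimes.\<close>
  show "b0\<^sup>2 + b1\<^sup>2 + t * (26458/10000 + 2 * t - (b0 + b1)) \<le> 2285/1000"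
    if "b0 + b1 + 3 * t \<le> 26458/10000"
  proof -
    note that = that[unfolded b]
    consider "t \<le> 3/10" | "3/10 \<le> t" by linarith
    then show ?thesis
    proof cases
      case 1
      have "t \<le> 3/10" using that lin 1 by simp
      then have "t * (26458/10000 + 2 * t) \<le> t * (32458/10000)"
        using \<open>0 \<le> t\<close> by (intro mult_left_mono) auto
      moreover have "b0\<^sup>2 + b1\<^sup>2 + t * (26458/10000 + 2 * t - (b0 + b1))
          \<le> d0 * 1 + d1 * 2 + t * (26458/10000 + 2 * t)"
        by (rule abel) (use lin that 1 in \<open>simp_all add: b\<close>)
      moreover have "d0 * 1 + d1 * 2 + t * (32458/10000) \<le> 2285/1000"
        using lin that 1 by simp
      ultimately show ?thesis by linarith
    next
      case 2
      have "t \<le> 5292/10000" using that lin 2 by simp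
      then have "t * (26458/10000 + 2 * t) \<le> t * (37042/10000)"
        using \<open>0 \<le> t\<close> by (intro mult_left_mono) auto
      moreover have "b0\<^sup>2 + b1\<^sup>2 + t * (26458/10000 + 2 * t - (b0 + b1))
          \<le> d0 * 1 + d1 * (17458/10000) + t * (26458/10000 + 2 * t)"
        by (rule abel) (use lin that 2 in \<open>simp_all add: b\<close>)
      moreover have "d0 * 1 + d1 * (17458/10000) + t * (37042/10000) \<le> 2285/1000"
        using lin that 2 by simp
      ultimately show ?thesis by linarith
    qed
  qed
qed

lemma profile_dims_8_9:
  fixes b0 b1 t :: real
  assumes sorted: "b1 \<le> b0" "t \<le> b1"
    and "0 \<le> t"
    and bounds: "b0 \<le> 1" "b0 + b1 \<le> 14143/10000"
  shows "b0\<^sup>2 + b1\<^sup>2 + t * (3 - (b0 + b1)) \<le> 2222/1000"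
    and "b0 + b1 + 4 * t \<le> 3 \<Longrightarrow>
      b0\<^sup>2 + b1\<^sup>2 + t * (3 + 2 * t - (b0 + b1)) \<le> 2222/1000"
proof -
  define d0 d1 where
    "d0 = b0 - b1" and "d1 = b1 - t"
  note d_defs = d0_def d1_def
  have b: "b0 = d0 + d1 + t" "b1 = d1 + t"
    by (simp_all add: d_defs)
  have "0 \<le> d0" "0 \<le> d1"
    using sorted by (auto simp: d_defs)
  note lin = this bounds[unfolded b] \<open>0 \<le> t\<close>
  note abel = abel_2[OF sorted, folded d_defs]
  show "b0\<^sup>2 + b1\<^sup>2 + t * (3 - (b0 + b1)) \<le> 2222/1000"
  proof -
    have "b0\<^sup>2 + b1\<^sup>2 + t * (3 - (b0 + b1))
        \<le> d0 * 1 + d1 * (14143/10000) + t * 3"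
      by (rule abel) (use lin in \<open>simp_all add: b\<close>)
    also have "\<dots> \<le> 2222/1000"
      using lin by simp
    finally show ?thesis .
  qed
  show "b0\<^sup>2 + b1\<^sup>2 + t * (3 + 2 * t - (b0 + b1)) \<le> 2222/1000"
    if "b0 + b1 + 4 * t \<le> 3"
  proof -
    note that = that[unfolded b]
    have "t \<le> 1/2" using that lin by simp
    then have "t * (3 + 2 * t) \<le> t * 4"
      using \<open>0 \<le> t\<close> by (intro mult_left_mono) auto
    moreover have "b0\<^sup>2 + b1\<^sup>2 + t * (3 + 2 * t - (b0 + b1))
        \<le> d0 * 1 + d1 * (14143/10000) + t * (3 + 2 * t)"
      by (rule abel) (use lin that in \<open>simp_all add: b\<close>)
    moreover have "d0 * 1 + d1 * (14143/10000) + t * 4 \<le> 2222/1000"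
      using lin that by simp
    ultimately show ?thesis by linarith
  qed
qed

lemma profile_dims_10_11:
  fixes b0 b1 b2 b3 t :: real
  assumes sorted: "b1 \<le> b0" "b2 \<le> b1" "b3 \<le> b2" "t \<le> b3"
    and "0 \<le> t"
    and bounds: "b0 \<le> 1" "b0 + b1 \<le> 14143/10000" "b2 + b3 + t \<le> 17321/10000"
  shows "b0\<^sup>2 + b1\<^sup>2 + b2\<^sup>2 + b3\<^sup>2 + t * (33167/10000 - (b0 + b1 + b2 + b3)) \<le> 21815/10000"
    and "b0 + b1 + b2 + b3 + 4 * t \<le> 33167/10000 \<Longrightarrow>
      b0\<^sup>2 + b1\<^sup>2 + b2\<^sup>2 + b3\<^sup>2 + t * (33167/10000 + 2 * t - (b0 + b1 + b2 + b3)) \<le> 21815/10000"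
proof -
  define d0 d1 d2 d3 where
    "d0 = b0 - b1" and "d1 = b1 - b2" and "d2 = b2 - b3" and "d3 = b3 - t"
  note d_defs = d0_def d1_def d2_def d3_def
  have b: "b0 = d0 + d1 + d2 + d3 + t" "b1 = d1 + d2 + d3 + t" "b2 = d2 + d3 + t" "b3 = d3 + t"
    by (simp_all add: d_defs)
  have "0 \<le> d0" "0 \<le> d1" "0 \<le> d2" "0 \<le> d3"
    using sorted by (auto simp: d_defs)
  note lin = this bounds[unfolded b] \<open>0 \<le> t\<close>
  note abel = abel_4[OF sorted, folded d_defs]
  show "b0\<^sup>2 + b1\<^sup>2 + b2\<^sup>2 + b3\<^sup>2 + t * (33167/10000 - (b0 + b1 + b2 + b3)) \<le> 21815/10000"
  proof -
    have "b0\<^sup>2 + b1\<^sup>2 + b2\<^sup>2 + b3\<^sup>2 + t * (33167/10000 - (b0 + b1 + b2 + b3))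
        \<le> d0 * 1 + d1 * (14143/10000) + d2 * (21215/10000) + d3 * (28286/10000) + t * (33167/10000)"
      by (rule abel) (use lin in \<open>simp_all add: b\<close>)
    also have "\<dots> \<le> 21815/10000"
      using lin by simp
    finally show ?thesis .
  qed
  show "b0\<^sup>2 + b1\<^sup>2 + b2\<^sup>2 + b3\<^sup>2 + t * (33167/10000 + 2 * t - (b0 + b1 + b2 + b3)) \<le> 21815/10000"
    if "b0 + b1 + b2 + b3 + 4 * t \<le> 33167/10000"
  proof -
    note that = that[unfolded b]
    have "t \<le> 4147/10000" using that lin by simp
    then have "t * (33167/10000 + 2 * t) \<le> t * (41461/10000)"
      using \<open>0 \<le> t\<close> by (intro mult_left_mono) auto
    moreover have "b0\<^sup>2 + b1\<^sup>2 + b2\<^sup>2 + b3\<^sup>2 + t * (33167/10000 + 2 * t - (b0 + b1 + b2 + b3))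
        \<le> d0 * 1 + d1 * (14143/10000) + d2 * (21215/10000) + d3 * (28286/10000) + t * (33167/10000 + 2 * t)"
      by (rule abel) (use lin that in \<open>simp_all add: b\<close>)
    moreover have "d0 * 1 + d1 * (14143/10000) + d2 * (21215/10000) + d3 * (28286/10000) + t * (41461/10000) \<le> 21815/10000"
      using lin that by simp
    ultimately show ?thesis by linarith
  qed
qed

lemma profile_dims_12_13:
  fixes b0 b1 b2 t :: real
  assumes sorted: "b1 \<le> b0" "b2 \<le> b1" "t \<le> b2"
    and "0 \<le> t"
    and bounds: "b0 \<le> 1" "b0 + b1 + b2 \<le> 17321/10000"
  shows "b0\<^sup>2 + b1\<^sup>2 + b2\<^sup>2 + t * (36056/10000 - (b0 + b1 + b2)) \<le> 21535/10000"
    and "b0 + b1 + b2 + 7 * t \<le> 36056/10000 \<Longrightarrow>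
      b0\<^sup>2 + b1\<^sup>2 + b2\<^sup>2 + t * (36056/10000 + 2 * t - (b0 + b1 + b2)) \<le> 21535/10000"
proof -
  define d0 d1 d2 where
    "d0 = b0 - b1" and "d1 = b1 - b2" and "d2 = b2 - t"
  note d_defs = d0_def d1_def d2_def
  have b: "b0 = d0 + d1 + d2 + t" "b1 = d1 + d2 + t" "b2 = d2 + t"
    by (simp_all add: d_defs)
  have "0 \<le> d0" "0 \<le> d1" "0 \<le> d2"
    using sorted by (auto simp: d_defs)
  note lin = this bounds[unfolded b] \<open>0 \<le> t\<close>
  note abel = abel_3[OF sorted, folded d_defs]
  show "b0\<^sup>2 + b1\<^sup>2 + b2\<^sup>2 + t * (36056/10000 - (b0 + b1 + b2)) \<le> 21535/10000"
  proof -
    have "b0\<^sup>2 + b1\<^sup>2 + b2\<^sup>2 + t * (36056/10000 - (b0 + b1 + b2))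
        \<le> d0 * 1 + d1 * (17321/10000) + d2 * (17321/10000) + t * (36056/10000)"
      by (rule abel) (use lin in \<open>simp_all add: b\<close>)
    also have "\<dots> \<le> 21535/10000"
      using lin by simp
    finally show ?thesis .
  qed
  show "b0\<^sup>2 + b1\<^sup>2 + b2\<^sup>2 + t * (36056/10000 + 2 * t - (b0 + b1 + b2)) \<le> 21535/10000"
    if "b0 + b1 + b2 + 7 * t \<le> 36056/10000"
  proof -
    note that = that[unfolded b]
    have "t \<le> 3606/10000" using that lin by simp
    then have "t * (36056/10000 + 2 * t) \<le> t * (43268/10000)"
      using \<open>0 \<le> t\<close> by (intro mult_left_mono) auto
    moreover have "b0\<^sup>2 + b1\<^sup>2 + b2\<^sup>2 + t * (36056/10000 + 2 * t - (b0 + b1 + b2))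
        \<le> d0 * 1 + d1 * (17321/10000) + d2 * (17321/10000) + t * (36056/10000 + 2 * t)"
      by (rule abel) (use lin that in \<open>simp_all add: b\<close>)
    moreover have "d0 * 1 + d1 * (17321/10000) + d2 * (17321/10000) + t * (43268/10000) \<le> 21535/10000"
      using lin that by simp
    ultimately show ?thesis by linarith
  qed
qed

lemma profile_dims_14_15:
  fixes b0 b1 b2 b3 b4 b5 t :: real
  assumes sorted: "b1 \<le> b0" "b2 \<le> b1" "b3 \<le> b2" "b4 \<le> b3" "b5 \<le> b4" "t \<le> b5"
    and "0 \<le> t"
    and bounds: "b0 \<le> 1" "b0 + b1 + b2 \<le> 17321/10000" "b3 + b4 + b5 + t \<le> 2"
  shows "b0\<^sup>2 + b1\<^sup>2 + b2\<^sup>2 + b3\<^sup>2 + b4\<^sup>2 + b5\<^sup>2 + t * (3873/1000 - (b0 + b1 + b2 + b3 + b4 + b5)) \<le> 2133/1000"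
    and "b0 + b1 + b2 + b3 + b4 + b5 + 6 * t \<le> 3873/1000 \<Longrightarrow>
      b0\<^sup>2 + b1\<^sup>2 + b2\<^sup>2 + b3\<^sup>2 + b4\<^sup>2 + b5\<^sup>2 + t * (3873/1000 + 2 * t - (b0 + b1 + b2 + b3 + b4 + b5)) \<le> 2133/1000"
proof -
  define d0 d1 d2 d3 d4 d5 where
    "d0 = b0 - b1" and "d1 = b1 - b2" and "d2 = b2 - b3" and "d3 = b3 - b4" and
    "d4 = b4 - b5" and "d5 = b5 - t"
  note d_defs = d0_def d1_def d2_def d3_def d4_def d5_def
  have b: "b0 = d0 + d1 + d2 + d3 + d4 + d5 + t" "b1 = d1 + d2 + d3 + d4 + d5 + t"
    "b2 = d2 + d3 + d4 + d5 + t" "b3 = d3 + d4 + d5 + t" "b4 = d4 + d5 + t" "b5 = d5 + t"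
    by (simp_all add: d_defs)
  have "0 \<le> d0" "0 \<le> d1" "0 \<le> d2" "0 \<le> d3" "0 \<le> d4" "0 \<le> d5"
    using sorted by (auto simp: d_defs)
  note lin = this bounds[unfolded b] \<open>0 \<le> t\<close>
  note abel = abel_6[OF sorted, folded d_defs]
  \<comment> \<open>Without a case distinction the linearisation gives only about \<open>2.169\<close>. If \<open>b0\<close> is small then so are the
    first two partial sums, and if it is large then the later ones are.\<close>
  show "b0\<^sup>2 + b1\<^sup>2 + b2\<^sup>2 + b3\<^sup>2 + b4\<^sup>2 + b5\<^sup>2 + t * (3873/1000 - (b0 + b1 + b2 + b3 + b4 + b5)) \<le> 2133/1000"
  proof (cases "b0 \<le> 83/100")
    case True
    note True = True[unfolded b]
    have "b0\<^sup>2 + b1\<^sup>2 + b2\<^sup>2 + b3\<^sup>2 + b4\<^sup>2 + b5\<^sup>2 + t * (3873/1000 - (b0 + b1 + b2 + b3 + b4 + b5))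
        \<le> d0 * (83/100) + d1 * (166/100) + d2 * (17321/10000) + d3 * (23095/10000)
            + d4 * (28869/10000) + d5 * (34642/10000) + t * (3873/1000)"
      by (rule abel) (use lin True in \<open>simp_all add: b\<close>)
    also have "\<dots> \<le> 2133/1000"
      using lin True by simp
    finally show ?thesis .
  next
    case False
    note False = False[unfolded b]
    have "b0\<^sup>2 + b1\<^sup>2 + b2\<^sup>2 + b3\<^sup>2 + b4\<^sup>2 + b5\<^sup>2 + t * (3873/1000 - (b0 + b1 + b2 + b3 + b4 + b5))
        \<le> d0 * 1 + d1 * (17321/10000) + d2 * (17321/10000) + d3 * (21835/10000)
            + d4 * (2635/1000) + d5 * (30865/10000) + t * (3873/1000)"
      by (rule abel) (use lin False in \<open>simp_all add: b\<close>)
    also have "\<dots> \<le> 2133/1000"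
      using lin False by simp
    finally show ?thesis .
  qed
  show "b0\<^sup>2 + b1\<^sup>2 + b2\<^sup>2 + b3\<^sup>2 + b4\<^sup>2 + b5\<^sup>2 + t * (3873/1000 + 2 * t - (b0 + b1 + b2 + b3 + b4 + b5)) \<le> 2133/1000"
    if "b0 + b1 + b2 + b3 + b4 + b5 + 6 * t \<le> 3873/1000"
  proof -
    note that = that[unfolded b]
    have "t \<le> 323/1000" using that lin by simp
    then have "t * (3873/1000 + 2 * t) \<le> t * (4519/1000)"
      using \<open>0 \<le> t\<close> by (intro mult_left_mono) auto
    moreover have "b0\<^sup>2 + b1\<^sup>2 + b2\<^sup>2 + b3\<^sup>2 + b4\<^sup>2 + b5\<^sup>2 + t * (3873/1000 + 2 * t - (b0 + b1 + b2 + b3 + b4 + b5))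
        \<le> d0 * 1 + d1 * (17321/10000) + d2 * (17321/10000) + d3 * (23095/10000)
            + d4 * (28869/10000) + d5 * (34642/10000) + t * (3873/1000 + 2 * t)"
      by (rule abel) (use lin that in \<open>simp_all add: b\<close>)
    moreover have "d0 * 1 + d1 * (17321/10000) + d2 * (17321/10000) + d3 * (23095/10000) + d4 * (28869/10000) + d5 * (34642/10000) + t * (4519/1000) \<le> 2133/1000"
      using lin that by simp
    ultimately show ?thesis by linarith
  qed
qed

text \<open>The hypotheses say that a vector is in no cap of the covering, scaled such that the common bound on
  the inner products is \<open>1\<close>: they come from the coordinate vectors, from the sign vectors supported on the \<open>n div 4\<close>
  largest coordinates, from those supported on \<open>n div 4 + 1\<close> coordinates of one block, and from the half cube.
  The value \<open>2 * (n + 1) / n\<close> is the squared norm that such a vector has.\<close>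

lemma profile_bound:
  fixes b :: "nat \<Rightarrow> real"
  assumes n: "7 \<le> n" "n \<le> 15"
    and mono: "\<And>i l. i \<le> l \<Longrightarrow> l < n \<Longrightarrow> b l \<le> b i"
    and nonneg: "\<And>i. i < n \<Longrightarrow> 0 \<le> b i"
    and total: "(\<Sum>i<n. b i) - 2 * b (n - 1) \<le> sqrt n"
    and first: "b 0 \<le> 1"
    and top: "(\<Sum>i<n div 4. b i) \<le> sqrt (real (n div 4))"
    and block: "2 \<le> n mod 4 \<Longrightarrow> (\<Sum>i = n div 4..<2 * (n div 4) + 1. b i) \<le> sqrt (real (n div 4 + 1))"
  shows "(\<Sum>i<n. (b i)\<^sup>2) < 2 * (real n + 1) / real n"
proof -
  have sqrt2: "sqrt 2 \<le> 14143/10000" and sqrt3: "sqrt 3 \<le> 17321/10000"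
    by (rule real_le_lsqrt; simp add: power2_eq_square)+
  \<comment> \<open>The head of the sequence that is treated exactly consists of \<open>n div 4\<close> terms, or of twice as many
    if there are block supports.\<close>
  consider "n \<in> {7}" | "n \<in> {8,9}" | "n \<in> {10,11}" | "n \<in> {12,13}" | "n \<in> {14,15}"
    using n by fastforce
  then show ?thesis
  proof cases
    case 1
    have "sqrt n \<le> 26458/10000"
      by (rule real_le_lsqrt) (use 1 in \<open>auto simp: power2_eq_square\<close>)
    with total have total: "(\<Sum>i<n. b i) - 2 * b (n - 1) \<le> 26458/10000" by linarith
    have sum: "(\<Sum>i<2. f i) = f 0 + f 1" for f :: "nat \<Rightarrow> real"
      by (simp add: eval_nat_numeral)
    have sorted: "b 1 \<le> b 0" "b 2 \<le> b 1"
      using 1 by (auto intro!: mono)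
    have k: "n div 4 = 1" using 1 by auto
    have "(\<Sum>i=1..<3. b i) = b 1 + b 2" by (simp add: eval_nat_numeral)
    moreover have "2 \<le> n mod 4" using 1 by auto
    ultimately have block: "b 1 + b 2 \<le> 14143/10000" using block k sqrt2 by simp
    note cons = first block
    have "(\<Sum>i<n. (b i)\<^sup>2) \<le> 2285/1000"
    proof (rule tail_bound_le[where j = 2 and \<nu> = 3, OF _ nonneg _ total])
      show "b l \<le> b i" if "i \<le> l" "l < n" for i l using that by (rule mono)
      show "2 + 2 < n" "3 \<le> n - 2 - 2" using 1 by auto
      fix t :: real assume t: "0 \<le> t" "t \<le> b 2"
      have t_cons: "b 1 + t \<le> 14143/10000" using cons(2) t(2) by linarith
      show "(\<Sum>i<2. (b i)\<^sup>2) + t * (26458/10000 - (\<Sum>i<2. b i)) \<le> 2285/1000"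
        unfolding sum by (rule profile_dim_7(1)[OF sorted(1) order_trans[OF t(2) sorted(2)] t(1) cons(1) t_cons])
      assume "(\<Sum>i<2. b i) + real 3 * t \<le> 26458/10000"
      then show "(\<Sum>i<2. (b i)\<^sup>2) + t * (26458/10000 + 2 * t - (\<Sum>i<2. b i)) \<le> 2285/1000"
        unfolding sum of_nat_numeral by (rule profile_dim_7(2)[OF sorted(1) order_trans[OF t(2) sorted(2)] t(1) cons(1) t_cons])
    qed
    also have "2285/1000 < 2 * (real n + 1) / real n" using 1 by auto
    finally show ?thesis .
  next
    case 2
    have "sqrt n \<le> 3"
      by (rule real_le_lsqrt) (use 2 in \<open>auto simp: power2_eq_square\<close>)
    with total have total: "(\<Sum>i<n. b i) - 2 * b (n - 1) \<le> 3" by linarith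
    have sum: "(\<Sum>i<2. f i) = f 0 + f 1" for f :: "nat \<Rightarrow> real"
      by (simp add: eval_nat_numeral)
    have sorted: "b 1 \<le> b 0" "b 2 \<le> b 1"
      using 2 by (auto intro!: mono)
    have k: "n div 4 = 2" using 2 by auto
    have "(\<Sum>i<2. b i) = b 0 + b 1" by (simp add: eval_nat_numeral)
    with top k sqrt2 have top: "b 0 + b 1 \<le> 14143/10000" by simp
    note cons = first top
    have "(\<Sum>i<n. (b i)\<^sup>2) \<le> 2222/1000"
    proof (rule tail_bound_le[where j = 2 and \<nu> = 4, OF _ nonneg _ total])
      show "b l \<le> b i" if "i \<le> l" "l < n" for i l using that by (rule mono)
      show "2 + 2 < n" "4 \<le> n - 2 - 2" using 2 by auto
      fix t :: real assume t: "0 \<le> t" "t \<le> b 2"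
      show "(\<Sum>i<2. (b i)\<^sup>2) + t * (3 - (\<Sum>i<2. b i)) \<le> 2222/1000"
        unfolding sum by (rule profile_dims_8_9(1)[OF sorted(1) order_trans[OF t(2) sorted(2)] t(1) cons(1) cons(2)])
      assume "(\<Sum>i<2. b i) + real 4 * t \<le> 3"
      then show "(\<Sum>i<2. (b i)\<^sup>2) + t * (3 + 2 * t - (\<Sum>i<2. b i)) \<le> 2222/1000"
        unfolding sum of_nat_numeral by (rule profile_dims_8_9(2)[OF sorted(1) order_trans[OF t(2) sorted(2)] t(1) cons(1) cons(2)])
    qed
    also have "2222/1000 < 2 * (real n + 1) / real n" using 2 by auto
    finally show ?thesis .
  next
    case 3
    have "sqrt n \<le> 33167/10000"
      by (rule real_le_lsqrt) (use 3 in \<open>auto simp: power2_eq_square\<close>)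
    with total have total: "(\<Sum>i<n. b i) - 2 * b (n - 1) \<le> 33167/10000" by linarith
    have sum: "(\<Sum>i<4. f i) = f 0 + f 1 + f 2 + f 3" for f :: "nat \<Rightarrow> real"
      by (simp add: eval_nat_numeral)
    have sorted: "b 1 \<le> b 0" "b 2 \<le> b 1" "b 3 \<le> b 2" "b 4 \<le> b 3"
      using 3 by (auto intro!: mono)
    have k: "n div 4 = 2" using 3 by auto
    have "(\<Sum>i<2. b i) = b 0 + b 1" by (simp add: eval_nat_numeral)
    with top k sqrt2 have top: "b 0 + b 1 \<le> 14143/10000" by simp
    have "(\<Sum>i=2..<5. b i) = b 2 + b 3 + b 4" by (simp add: eval_nat_numeral)
    moreover have "2 \<le> n mod 4" using 3 by auto
    ultimately have block: "b 2 + b 3 + b 4 \<le> 17321/10000" using block k sqrt3 by simp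
    note cons = first top block
    have "(\<Sum>i<n. (b i)\<^sup>2) \<le> 21815/10000"
    proof (rule tail_bound_le[where j = 4 and \<nu> = 4, OF _ nonneg _ total])
      show "b l \<le> b i" if "i \<le> l" "l < n" for i l using that by (rule mono)
      show "4 + 2 < n" "4 \<le> n - 4 - 2" using 3 by auto
      fix t :: real assume t: "0 \<le> t" "t \<le> b 4"
      have t_cons: "b 2 + b 3 + t \<le> 17321/10000" using cons(3) t(2) by linarith
      show "(\<Sum>i<4. (b i)\<^sup>2) + t * (33167/10000 - (\<Sum>i<4. b i)) \<le> 21815/10000"
        unfolding sum by (rule profile_dims_10_11(1)[OF sorted(1) sorted(2) sorted(3) order_trans[OF t(2) sorted(4)] t(1) cons(1) cons(2) t_cons])
      assume "(\<Sum>i<4. b i) + real 4 * t \<le> 33167/10000"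
      then show "(\<Sum>i<4. (b i)\<^sup>2) + t * (33167/10000 + 2 * t - (\<Sum>i<4. b i)) \<le> 21815/10000"
        unfolding sum of_nat_numeral by (rule profile_dims_10_11(2)[OF sorted(1) sorted(2) sorted(3) order_trans[OF t(2) sorted(4)] t(1) cons(1) cons(2) t_cons])
    qed
    also have "21815/10000 < 2 * (real n + 1) / real n" using 3 by auto
    finally show ?thesis .
  next
    case 4
    have "sqrt n \<le> 36056/10000"
      by (rule real_le_lsqrt) (use 4 in \<open>auto simp: power2_eq_square\<close>)
    with total have total: "(\<Sum>i<n. b i) - 2 * b (n - 1) \<le> 36056/10000" by linarith
    have sum: "(\<Sum>i<3. f i) = f 0 + f 1 + f 2" for f :: "nat \<Rightarrow> real"
      by (simp add: eval_nat_numeral)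
    have sorted: "b 1 \<le> b 0" "b 2 \<le> b 1" "b 3 \<le> b 2"
      using 4 by (auto intro!: mono)
    have k: "n div 4 = 3" using 4 by auto
    have "(\<Sum>i<3. b i) = b 0 + b 1 + b 2" by (simp add: eval_nat_numeral)
    with top k sqrt3 have top: "b 0 + b 1 + b 2 \<le> 17321/10000" by simp
    note cons = first top
    have "(\<Sum>i<n. (b i)\<^sup>2) \<le> 21535/10000"
    proof (rule tail_bound_le[where j = 3 and \<nu> = 7, OF _ nonneg _ total])
      show "b l \<le> b i" if "i \<le> l" "l < n" for i l using that by (rule mono)
      show "3 + 2 < n" "7 \<le> n - 3 - 2" using 4 by auto
      fix t :: real assume t: "0 \<le> t" "t \<le> b 3"
      show "(\<Sum>i<3. (b i)\<^sup>2) + t * (36056/10000 - (\<Sum>i<3. b i)) \<le> 21535/10000"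
        unfolding sum by (rule profile_dims_12_13(1)[OF sorted(1) sorted(2) order_trans[OF t(2) sorted(3)] t(1) cons(1) cons(2)])
      assume "(\<Sum>i<3. b i) + real 7 * t \<le> 36056/10000"
      then show "(\<Sum>i<3. (b i)\<^sup>2) + t * (36056/10000 + 2 * t - (\<Sum>i<3. b i)) \<le> 21535/10000"
        unfolding sum of_nat_numeral by (rule profile_dims_12_13(2)[OF sorted(1) sorted(2) order_trans[OF t(2) sorted(3)] t(1) cons(1) cons(2)])
    qed
    also have "21535/10000 < 2 * (real n + 1) / real n" using 4 by auto
    finally show ?thesis .
  next
    case 5
    have "sqrt n \<le> 3873/1000"
      by (rule real_le_lsqrt) (use 5 in \<open>auto simp: power2_eq_square\<close>)
    with total have total: "(\<Sum>i<n. b i) - 2 * b (n - 1) \<le> 3873/1000" by linarith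
    have sum: "(\<Sum>i<6. f i) = f 0 + f 1 + f 2 + f 3 + f 4 + f 5" for f :: "nat \<Rightarrow> real"
      by (simp add: eval_nat_numeral)
    have sorted: "b 1 \<le> b 0" "b 2 \<le> b 1" "b 3 \<le> b 2" "b 4 \<le> b 3" "b 5 \<le> b 4" "b 6 \<le> b 5"
      using 5 by (auto intro!: mono)
    have k: "n div 4 = 3" using 5 by auto
    have "(\<Sum>i<3. b i) = b 0 + b 1 + b 2" by (simp add: eval_nat_numeral)
    with top k sqrt3 have top: "b 0 + b 1 + b 2 \<le> 17321/10000" by simp
    have "(\<Sum>i=3..<7. b i) = b 3 + b 4 + b 5 + b 6" by (simp add: eval_nat_numeral)
    moreover have "2 \<le> n mod 4" using 5 by auto
    ultimately have block: "b 3 + b 4 + b 5 + b 6 \<le> 2" using block k by simp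
    note cons = first top block
    have "(\<Sum>i<n. (b i)\<^sup>2) \<le> 2133/1000"
    proof (rule tail_bound_le[where j = 6 and \<nu> = 6, OF _ nonneg _ total])
      show "b l \<le> b i" if "i \<le> l" "l < n" for i l using that by (rule mono)
      show "6 + 2 < n" "6 \<le> n - 6 - 2" using 5 by auto
      fix t :: real assume t: "0 \<le> t" "t \<le> b 6"
      have t_cons: "b 3 + b 4 + b 5 + t \<le> 2" using cons(3) t(2) by linarith
      show "(\<Sum>i<6. (b i)\<^sup>2) + t * (3873/1000 - (\<Sum>i<6. b i)) \<le> 2133/1000"
        unfolding sum by (rule profile_dims_14_15(1)[OF sorted(1) sorted(2) sorted(3) sorted(4) sorted(5) order_trans[OF t(2) sorted(6)] t(1) cons(1) cons(2) t_cons])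
      assume "(\<Sum>i<6. b i) + real 6 * t \<le> 3873/1000"
      then show "(\<Sum>i<6. (b i)\<^sup>2) + t * (3873/1000 + 2 * t - (\<Sum>i<6. b i)) \<le> 2133/1000"
        unfolding sum of_nat_numeral by (rule profile_dims_14_15(2)[OF sorted(1) sorted(2) sorted(3) sorted(4) sorted(5) order_trans[OF t(2) sorted(6)] t(1) cons(1) cons(2) t_cons])
    qed
    also have "2133/1000 < 2 * (real n + 1) / real n" using 5 by auto
    finally show ?thesis .
  qed
qed

section \<open>The covering of the sphere and its size\<close>

text \<open>Besides the singletons, all the sets of size \<open>k = n div 4\<close> are used, and if the remainder of \<open>n\<close>
  modulo 4 is at least 2 also those sets of size \<open>k + 1\<close> that do not cross the partition into \<open>B\<close> and its
  complement. There are few of the latter, and still any \<open>2 * k + 1\<close> coordinates contain one of them.\<close>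

definition supports :: "'n::finite set \<Rightarrow> 'n set set" where
  "supports B = {S. card S = 1} \<union> {S. card S = CARD('n) div 4} \<union>
     (if 2 \<le> CARD('n) mod 4
      then {S. S \<subseteq> B \<and> card S = CARD('n) div 4 + 1} \<union> {S. S \<subseteq> - B \<and> card S = CARD('n) div 4 + 1}
      else {})"

text \<open>A unit vector outside all the caps, with its absolute values sorted and divided by the cosine \<open>c\<close> of the radius,
  would contradict the profile bound, as the sum of its squares is exactly \<open>1 / c\<^sup>2\<close>.\<close>

lemma sign_vecs_half_cube_cover:
  fixes v :: "real ^ 'n" and B :: "'n set"
  assumes n: "7 \<le> CARD('n)" "CARD('n) \<le> 15" and v: "norm v = 1"
  shows "\<exists>e \<in> sign_vecs (supports B) \<union> half_cube. e \<bullet> v > sqrt (CARD('n) / (2 * (CARD('n) + 1)))"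
proof (rule ccontr)
  define n where "n = CARD('n)"
  define k where "k = n div 4"
  define c where "c = sqrt (real n / (2 * (real n + 1)))"
  have n: "7 \<le> n" "n \<le> 15" using n by (auto simp: n_def)
  then have k: "1 \<le> k" "2 * k + 1 \<le> n" by (auto simp: k_def)
  have "c > 0" using n by (simp add: c_def)
  assume "\<not> ?thesis"
  then have small: "e \<bullet> v \<le> c" if "e \<in> sign_vecs (supports B) \<union> half_cube" for e
    using that by (auto simp: c_def n_def not_less add.commute)
  obtain \<pi> where \<pi>: "bij_betw \<pi> {..<n} UNIV"
    and dec: "\<And>i l. i \<le> l \<Longrightarrow> l < n \<Longrightarrow> \<bar>v $ \<pi> l\<bar> \<le> \<bar>v $ \<pi> i\<bar>"
    using decreasing_enumeration[of "\<lambda>i. \<bar>v $ i\<bar>"] unfolding n_def by blast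
  define b where "b i = \<bar>v $ \<pi> i\<bar> / c" for i
  have inj: "inj_on \<pi> I" if "I \<subseteq> {..<n}" for I
    using \<pi> that by (meson bij_betw_def inj_on_subset)
  have abs_v: "\<bar>v $ \<pi> i\<bar> = c * b i" for i
    using \<open>c > 0\<close> by (simp add: b_def)
  have sum_image: "(\<Sum>i\<in>\<pi> ` I. \<bar>v $ i\<bar>) = c * sum b I" if "I \<subseteq> {..<n}" for I
    using inj[OF that] by (simp add: sum.reindex abs_v sum_distrib_left)
  have sum_UNIV: "(\<Sum>i\<in>UNIV. f i) = (\<Sum>i<n. f (\<pi> i))" for f :: "'n \<Rightarrow> real"
    using \<pi> by (simp add: sum.reindex_bij_betw)
  have support: "sum b I \<le> sqrt (card I)" if I: "I \<subseteq> {..<n}" "\<pi> ` I \<in> supports B" for I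
  proof (cases "I = {}")
    case False
    then have "card I > 0" using I(1) finite_subset by (auto simp: card_gt_0_iff)
    obtain e where "e \<in> sign_vecs (supports B)"
        "e \<bullet> v = (\<Sum>i\<in>\<pi> ` I. \<bar>v $ i\<bar>) / sqrt (card (\<pi> ` I))"
      using sign_vecs_inner[OF I(2)] by blast
    then have "c * sum b I / sqrt (card I) \<le> c"
      using small[of e] sum_image[OF I(1)] card_image[OF inj[OF I(1)]] by simp
    then show ?thesis
      using \<open>c > 0\<close> \<open>card I > 0\<close> by (simp add: divide_le_eq)
  qed simp
  have mono: "b l \<le> b i" if "i \<le> l" "l < n" for i l
    using dec[OF that] \<open>c > 0\<close> by (simp add: b_def divide_right_mono)
  have "(\<Sum>i<n. (b i)\<^sup>2) < 2 * (real n + 1) / real n"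
  proof (rule profile_bound)
    show "7 \<le> n" "n \<le> 15" using n by auto
    show "b l \<le> b i" if "i \<le> l" "l < n" for i l using mono that .
    show "0 \<le> b i" for i using \<open>c > 0\<close> by (simp add: b_def)
    have "{0} \<subseteq> {..<n}" using n by auto
    from support[OF this] show "b 0 \<le> 1"
      by (simp add: supports_def)
    have "{..<k} \<subseteq> {..<n}" using k by auto
    from support[OF this] card_image[OF inj[OF this]]
    show "(\<Sum>i<n div 4. b i) \<le> sqrt (real (n div 4))"
      by (simp add: supports_def k_def n_def)
    obtain e where "e \<in> half_cube"
        "e \<bullet> v \<ge> ((\<Sum>i\<in>UNIV. \<bar>v $ i\<bar>) - 2 * \<bar>v $ \<pi> (n - 1)\<bar>) / sqrt n"
      using half_cube_inner[of v "\<pi> (n - 1)"] by (auto simp: n_def)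
    then have "(c * (\<Sum>i<n. b i) - 2 * (c * b (n - 1))) / sqrt n \<le> c"
      using small[of e] by (simp add: sum_UNIV abs_v sum_distrib_left)
    then have "c * ((\<Sum>i<n. b i) - 2 * b (n - 1)) \<le> c * sqrt n"
      using n by (simp add: divide_le_eq algebra_simps)
    then show "(\<Sum>i<n. b i) - 2 * b (n - 1) \<le> sqrt n"
      using \<open>c > 0\<close> by simp
    show "(\<Sum>i = n div 4..<2 * (n div 4) + 1. b i) \<le> sqrt (real (n div 4 + 1))"
      if blocks: "2 \<le> n mod 4"
    proof -
      let ?m = "2 * k + 1"
      \<comment> \<open>By the pigeonhole principle one of the two blocks contains \<open>k + 1\<close> of the \<open>2 * k + 1\<close> largest coordinates;
        in the worst case these are the last ones.\<close>
      define I where "I = {i. i < ?m \<and> \<pi> i \<in> B}"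
      have "card I + card ({..<?m} - I) = ?m"
        using card_Diff_subset[of I "{..<?m}"] card_mono[of "{..<?m}" I] finite_subset[of I "{..<?m}"]
        by (auto simp: I_def subset_iff)
      then consider "k + 1 \<le> card I" | "k + 1 \<le> card ({..<?m} - I)" by linarith
      then obtain J where J: "J \<subseteq> {..<?m}" "card J = k + 1" "\<pi> ` J \<subseteq> B \<or> \<pi> ` J \<subseteq> - B"
      proof cases
        case 1
        then obtain J where "J \<subseteq> I" "card J = k + 1" by (meson obtain_subset_with_card_n)
        then show thesis by (intro that[of J]) (auto simp: I_def)
      next
        case 2
        then obtain J where "J \<subseteq> {..<?m} - I" "card J = k + 1" by (meson obtain_subset_with_card_n)
        then show thesis by (intro that[of J]) (auto simp: I_def)
      qed
      have "J \<subseteq> {..<n}" using J(1) k by auto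
      moreover have "\<pi> ` J \<in> supports B"
        using J card_image[OF inj[OF calculation]] blocks by (auto simp: supports_def k_def n_def)
      ultimately have "sum b J \<le> sqrt (card J)" by (rule support)
      moreover have "(\<Sum>i=k..<?m. b i) \<le> sum b J"
        using J k by (intro sum_decreasing_ge_last mono) auto
      ultimately show ?thesis using J(2) by (simp add: k_def)
    qed
  qed
  moreover have "(\<Sum>i<n. (b i)\<^sup>2) = 2 * (real n + 1) / real n"
  proof -
    have "c\<^sup>2 * (\<Sum>i<n. (b i)\<^sup>2) = (\<Sum>i<n. (v $ \<pi> i)\<^sup>2)"
      unfolding sum_distrib_left by (intro sum.cong refl) (metis abs_v power2_abs power_mult_distrib)
    also have "\<dots> = v \<bullet> v"
      by (simp add: inner_vec_def sum_UNIV power2_eq_square)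
    also have "\<dots> = 1" using v by (simp add: norm_eq_1)
    finally show ?thesis
      using n by (simp add: c_def field_simps)
  qed
  ultimately show False by simp
qed

lemma card_sign_vecs_uniform:
  "card (sign_vecs {S. S \<subseteq> A \<and> card S = j}) \<le> (card A choose j) * 2 ^ j"
  using card_sign_vecs_le[of "{S. S \<subseteq> A \<and> card S = j}"] by (simp add: n_subsets)

lemma sign_vecs_Un: "sign_vecs (P \<union> Q) = sign_vecs P \<union> sign_vecs Q"
  by (auto simp: sign_vecs_def)

text \<open>The singletons are counted separately although for \<open>n = 7\<close> they are also the sets of size \<open>n div 4\<close>; with
  this double count the bound is attained for \<open>n = 7\<close>.\<close>

lemma support_count:
  fixes n :: nat
  assumes "7 \<le> n" "n \<le> 15"
  shows "(n choose 1) * 2 ^ 1 + (n choose (n div 4)) * 2 ^ (n div 4) +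
     (if 2 \<le> n mod 4 then (n div 2 choose (n div 4 + 1)) * 2 ^ (n div 4 + 1) +
        ((n - n div 2) choose (n div 4 + 1)) * 2 ^ (n div 4 + 1) else 0) \<le> 2 ^ (n - 1)"
proof -
  have "n \<in> {7, 8, 9, 10, 11, 12, 13, 14, 15}"
    using assms by fastforce
  then show ?thesis by (elim insertE) (simp_all add: binomial_fact' fact_numeral numeral_2_eq_2[symmetric])
qed

lemma card_sign_vecs_supports:
  fixes B :: "'n::finite set"
  assumes n: "7 \<le> CARD('n)" "CARD('n) \<le> 15" and B: "card B = CARD('n) div 2"
  shows "card (sign_vecs (supports B)) \<le> 2 ^ (CARD('n) - 1)"
proof -
  let ?n = "CARD('n)" and ?k = "CARD('n) div 4"
  note le = card_Un_le[THEN order_trans, OF add_mono]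
  have all: "card (sign_vecs {S :: 'n set. card S = j}) \<le> (?n choose j) * 2 ^ j" for j
    using card_sign_vecs_uniform[of "UNIV :: 'n set" j] by simp
  have blocks: "card (sign_vecs ({S. S \<subseteq> B \<and> card S = j} \<union> {S. S \<subseteq> - B \<and> card S = j}))
      \<le> (?n div 2 choose j) * 2 ^ j + ((?n - ?n div 2) choose j) * 2 ^ j" for j
    using card_sign_vecs_uniform[of B j] card_sign_vecs_uniform[of "- B" j] B
    unfolding sign_vecs_Un by (intro le) (simp_all add: Compl_eq_Diff_UNIV card_Diff_subset)
  have "card (sign_vecs (supports B)) \<le> (?n choose 1) * 2 ^ 1 + (?n choose ?k) * 2 ^ ?k +
     (if 2 \<le> ?n mod 4 then (?n div 2 choose (?k + 1)) * 2 ^ (?k + 1)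
         + ((?n - ?n div 2) choose (?k + 1)) * 2 ^ (?k + 1) else 0)"
    unfolding supports_def sign_vecs_Un[of "_ \<union> _"] sign_vecs_Un[of "{S. card S = 1}"]
    by (intro le all) (use blocks[of "?k + 1"] in \<open>auto simp: sign_vecs_def[of "{}"]\<close>)
  also have "\<dots> \<le> 2 ^ (?n - 1)"
    using support_count[OF n] by simp
  finally show ?thesis .
qed

section \<open>Illumination and X-raying\<close>

lemma uminus_sign_vecs: "e \<in> sign_vecs \<S> \<Longrightarrow> - e \<in> sign_vecs \<S>"
  unfolding sign_vecs_def by (fastforce simp: uminus_sign_vec)

lemma half_of_symmetric:
  fixes F :: "'a::real_vector set"
  assumes "finite F" "0 \<notin> F" "\<And>e. e \<in> F \<Longrightarrow> - e \<in> F"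
  obtains F' where "F' \<subseteq> F" "2 * card F' = card F" "\<And>e. e \<in> F \<Longrightarrow> e \<in> F' \<or> - e \<in> F'"
proof -
  have "\<exists>F'\<subseteq>F. 2 * card F' = card F \<and> (\<forall>e\<in>F. e \<in> F' \<or> - e \<in> F')"
    using assms
  proof (induction "card F" arbitrary: F rule: less_induct)
    case less
    show ?case
    proof (cases "F = {}")
      case False
      then obtain e where e: "e \<in> F" by blast
      with less.prems have "e \<noteq> 0" "- e \<in> F" by auto
      have "e \<noteq> - e"
      proof
        assume "e = - e"
        then have "2 *\<^sub>R e = 0" by (metis add.right_inverse scaleR_2)
        then show False using \<open>e \<noteq> 0\<close> by simp
      qed
      define G where "G = F - {e, - e}"
      have F: "F = insert e (insert (- e) G)" "e \<notin> insert (- e) G" "- e \<notin> G"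
        using e \<open>- e \<in> F\<close> \<open>e \<noteq> - e\<close> by (auto simp: G_def)
      have "finite G" using less.prems(1) by (simp add: G_def)
      then have card_F: "card F = Suc (Suc (card G))"
        using F by simp
      have "- x \<in> G" if "x \<in> G" for x
        using that less.prems(3) unfolding G_def by (auto simp: minus_equation_iff)
      moreover have "0 \<notin> G" using less.prems(2) by (simp add: G_def)
      ultimately obtain G' where G': "G' \<subseteq> G" "2 * card G' = card G" "\<forall>x\<in>G. x \<in> G' \<or> - x \<in> G'"
        using less.hyps[of G] \<open>finite G\<close> card_F by auto
      have "card (insert e G') = Suc (card G')"
        using G'(1) F(2) \<open>finite G\<close> finite_subset by (subst card_insert_disjoint) auto
      then show ?thesis
        using G' card_F F(1) by (intro exI[of _ "insert e G'"]) auto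
    qed simp
  qed
  then show ?thesis using that by blast
qed

lemma exists_half_card: "\<exists>B :: 'n::finite set. card B = CARD('n) div 2"
  by (meson div_le_dividend obtain_subset_with_card_n)

text \<open>The half cube is not symmetric in odd dimensions, so for the X-ray number only the sign vectors with
  supports in \<open>supports B\<close> are halved: \<open>2 ^ (n - 2) + 2 ^ (n - 1) = 3 * 2 ^ (n - 2)\<close>.\<close>

theorem mainTheorem2:
  fixes W :: "(real ^ 'n) set"
  assumes "7 \<le> CARD('n)" and "CARD('n) \<le> 15"
    and "convex_body W" and "constant_width W"
  shows "xray_number W \<le> enat (3 * 2 ^ (CARD('n) - 2)) \<and>
         illumination_number W \<le> enat (2 ^ CARD('n))"
proof -
  let ?n = "CARD('n)"
  obtain B :: "'n set" where B: "card B = ?n div 2"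
    using exists_half_card by blast
  define F where "F = sign_vecs (supports B)"
  define H where "H = (half_cube :: (real ^ 'n) set)"
  have pow: "(2::nat) ^ ?n = 2 * 2 ^ (?n - 1)" "(2::nat) ^ (?n - 1) = 2 * 2 ^ (?n - 2)"
    using assms(1) by (simp_all flip: power_Suc)
  have card: "card F \<le> 2 ^ (?n - 1)" "card H \<le> 2 ^ (?n - 1)"
    using card_sign_vecs_supports[OF assms(1,2) B] card_half_cube by (auto simp: F_def H_def)
  have "finite F" "finite H"
    by (auto simp: F_def H_def sign_vecs_def half_cube_def)
  have norm: "norm e = 1" if "e \<in> F \<union> H" for e
  proof -
    have "S \<noteq> {}" if "S \<in> supports B" for S
      using that assms(1) by (auto simp: supports_def split: if_splits)
    then show ?thesis
      using that by (auto simp: F_def H_def sign_vecs_def half_cube_def norm_sign_vec)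
  qed
  have "closed W"
    using assms(3) by (auto simp: convex_body_def compact_imp_closed)
  have illum: "\<exists>e\<in>F \<union> H. illuminated_along W x e" if x: "x \<in> W" for x
  proof -
    obtain v where v: "norm v = 1"
      "\<And>e. norm e = 1 \<Longrightarrow> e \<bullet> v > sqrt (DIM(real ^ 'n) / (2 * (DIM(real ^ 'n) + 1))) \<Longrightarrow> illuminated_along W x e"
      using constant_width_illumination_axis[OF assms(3,4) x] by blast
    obtain e where "e \<in> F \<union> H" "e \<bullet> v > sqrt (?n / (2 * (?n + 1)))"
      using sign_vecs_half_cube_cover[OF assms(1,2) v(1), of B] by (auto simp: F_def H_def)
    then show ?thesis
      using v(2)[of e] norm[of e] by auto
  qed
  have "illuminates (F \<union> H) W"
    using illum norm \<open>closed W\<close> frontier_subset_closed by (fastforce simp: illuminates_def)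
  then have "illumination_number W \<le> enat (card (F \<union> H))"
    unfolding illumination_number_def using \<open>finite F\<close> \<open>finite H\<close> by (intro INF_lower) auto
  also have "card (F \<union> H) \<le> 2 ^ ?n"
    using card_Un_le[of F H] card pow(1) by linarith
  finally have I: "illumination_number W \<le> enat (2 ^ ?n)" by simp
  obtain F' where F': "F' \<subseteq> F" "2 * card F' = card F" "\<And>e. e \<in> F \<Longrightarrow> e \<in> F' \<or> - e \<in> F'"
    using half_of_symmetric[of F] \<open>finite F\<close> norm uminus_sign_vecs unfolding F_def by (metis UnI1 norm_zero zero_neq_one)
  have xray: "xrayed_along W x e" if "illuminated_along W x e \<or> illuminated_along W x (- e)" for x e
    using that
  proof
    assume "illuminated_along W x (- e)"
    then obtain t where "x + t *\<^sub>R - e \<in> interior W"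
      by (auto simp: illuminated_along_def)
    then have "x + (- t) *\<^sub>R e \<in> interior W" by simp
    then show ?thesis unfolding xrayed_along_def by blast
  qed (auto simp: illuminated_along_def xrayed_along_def)
  have "xrays (F' \<union> H) W"
    unfolding xrays_def
  proof (intro conjI ballI)
    show "F' \<union> H \<subseteq> sphere 0 1" using norm F'(1) by auto
    fix x assume "x \<in> W"
    then obtain e where e: "e \<in> F \<union> H" "illuminated_along W x e" using illum by blast
    then consider "e \<in> F' \<union> H" | "- e \<in> F'" using F'(3) by blast
    then show "\<exists>e\<in>F' \<union> H. xrayed_along W x e"
      using xray e(2) by cases (metis, metis UnI1 minus_minus)
  qed
  then have "xray_number W \<le> enat (card (F' \<union> H))"
    unfolding xray_number_def using \<open>finite F\<close> \<open>finite H\<close> F'(1) finite_subset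
    by (intro INF_lower) auto
  also have "card (F' \<union> H) \<le> 3 * 2 ^ (?n - 2)"
    using card_Un_le[of F' H] card F'(2) pow(2) by linarith
  finally have "xray_number W \<le> enat (3 * 2 ^ (?n - 2))" by simp
  with I show ?thesis by blast
qed

end
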